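(* Let $x^0\in\mathrm{dom}(F)$ and suppose that $g$ is Lipschitz differentiable in $\mathcal{S}(x^0):=\{x:F(x)\le F(x^0)\}$ (that is, $g$ is differentiable in $\mathcal{S}(x^0)$ and $\nabla g$ is Lipschitz continuous there). Then the proximal damped Newton (PDN) method started at $x^0$ is globally linearly convergent, i.e. there exists $q\in(0,1)$ such that its iterates satisfy $$F(x^k)-F^*\le q^k(F(x^0)-F^* ),\qquad\forall k\ge0.$$ In particular, the damped Newton (DN) method (the case $g=0$) is globally linearly convergent in the same sense.
   Context: Problem and standing assumptions. Consider $F^*=\min_{x\in\mathbb{R}^N}\{F(x):=f(x)+g(x)\}$, where $f,g:\mathbb{R}^N\to\mathbb{R}\cup\{\infty\}$ and $g$ is proper closed convex. The function $f$ is standard self-concordant: it is a closed convex function with open domain $\mathrm{dom}(f)$, three times continuously differentiable on $\mathrm{dom}(f)$, and $|\psi'''(0)|\le 2(\psi''(0))^{3/2}$ for all $x\in\mathrm{dom}(f)$, $u\in\mathbb{R}^N$, where $\psi(t)=f(x+tu)$. Also $\nabla^2 f$ is continuous and positive definite on $\mathrm{dom}(F)$, and the problem has a unique optimal solution $x^*$ (so $F^*=F(x^* )$). PDN method. For $x\in\mathrm{dom}(F)$ let $\tilde d(x):=\arg\min_d\{f(x)+\langle\nabla f(x),d\rangle+\frac12\langle d,\nabla^2 f(x)d\rangle+g(x+d)\}$ and $\tilde\lambda(x):=\sqrt{\langle\tilde d(x),\nabla^2 f(x)\tilde d(x)\rangle}$. The PDN method generates $x^{k+1}=x^k+\tilde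 d(x^k)/(1+\tilde\lambda(x^k))$, $k\ge0$. The DN method is the PDN method in the case $g=0$, where $\tilde d(x)=-(\nabla^2 f(x))^{-1}\nabla f(x)$. *)

theory Defs
  imports "HOL-Analysis.Analysis"
begin

section \<open>Extended-valued functions\<close>

text \<open>Functions into \<open>\<real> \<union> {\<infinity>}\<close> are \<^typ>\<open>ereal\<close>-valued functions that avoid \<open>-\<infinity>\<close>.\<close>

definition edom :: "('a \<Rightarrow> ereal) \<Rightarrow> 'a set" where
  "edom f = {x. f x < \<infinity>}"

text \<open>The real-valued function underlying \<open>f\<close>; it carries information on \<^term>\<open>edom f\<close> only
  (it is \<open>0\<close> where \<open>f\<close> is infinite), so it must not be used at other points.\<close>

definition real_part :: "('a \<Rightarrow> ereal) \<Rightarrow> 'a \<Rightarrow> real" where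
  "real_part f x = real_of_ereal (f x)"

definition proper_fun :: "('a \<Rightarrow> ereal) \<Rightarrow> bool" where
  "proper_fun f \<longleftrightarrow> (\<forall>x. f x \<noteq> -\<infinity>) \<and> edom f \<noteq> {}"

definition closed_convex_fun :: "('a::real_normed_vector \<Rightarrow> ereal) \<Rightarrow> bool" where
  "closed_convex_fun f \<longleftrightarrow>
     convex_on (edom f) (real_part f) \<and> closed (epigraph (edom f) (real_part f))"


section \<open>Derivatives\<close>

definition gradient :: "(real ^ 'n \<Rightarrow> real) \<Rightarrow> real ^ 'n \<Rightarrow> real ^ 'n" where
  "gradient h x = (THE D. GDERIV h x :> D)"

definition hessian :: "(real ^ 'n \<Rightarrow> real) \<Rightarrow> real ^ 'n \<Rightarrow> real ^ 'n ^ 'n" where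
  "hessian h x = jacobian (gradient h) (at x)"

definition positive_definite :: "real ^ 'n ^ 'n \<Rightarrow> bool" where
  "positive_definite A \<longleftrightarrow> transpose A = A \<and> (\<forall>v. v \<noteq> 0 \<longrightarrow> v \<bullet> (A *v v) > 0)"

text \<open>\<open>k\<close> times continuously differentiable on an open set: all iterated directional
  derivatives up to order \<open>k\<close> are continuous.\<close>

primrec times_cont_diff_on ::
    "nat \<Rightarrow> (real ^ 'n \<Rightarrow> real) \<Rightarrow> (real ^ 'n) set \<Rightarrow> bool" where
  "times_cont_diff_on 0 h S \<longleftrightarrow> continuous_on S h"
| "times_cont_diff_on (Suc k) h S \<longleftrightarrow>
     (\<forall>x\<in>S. h differentiable (at x)) \<and>
     (\<forall>v. times_cont_diff_on k (\<lambda>x. frechet_derivative h (at x) v) S)"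

definition standard_self_concordant :: "(real ^ 'n \<Rightarrow> ereal) \<Rightarrow> bool" where
  "standard_self_concordant f \<longleftrightarrow>
     (\<forall>x. f x \<noteq> -\<infinity>) \<and> closed_convex_fun f \<and> open (edom f) \<and>
     times_cont_diff_on 3 (real_part f) (edom f) \<and>
     (\<forall>x\<in>edom f. \<forall>u. let \<psi> = (\<lambda>t::real. real_part f (x + t *\<^sub>R u)) in
        \<bar>(deriv ^^ 3) \<psi> 0\<bar> \<le> 2 * ((deriv ^^ 2) \<psi> 0) powr (3/2))"

text \<open>Differentiability is the usual one, at points with a neighbourhood on which \<open>g\<close> is finite.\<close>

definition lipschitz_differentiable_on ::
    "(real ^ 'n \<Rightarrow> ereal) \<Rightarrow> (real ^ 'n) set \<Rightarrow> bool" where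
  "lipschitz_differentiable_on g S \<longleftrightarrow>
     S \<subseteq> interior (edom g) \<and>
     (\<forall>x\<in>S. real_part g differentiable (at x)) \<and>
     (\<exists>L. L-lipschitz_on S (gradient (real_part g)))"


section \<open>The composite problem and the damped Newton methods\<close>

definition objective ::
    "(real ^ 'n \<Rightarrow> ereal) \<Rightarrow> (real ^ 'n \<Rightarrow> ereal) \<Rightarrow> real ^ 'n \<Rightarrow> ereal" where
  "objective f g x = f x + g x"

definition opt_value ::
    "(real ^ 'n \<Rightarrow> ereal) \<Rightarrow> (real ^ 'n \<Rightarrow> ereal) \<Rightarrow> ereal" where
  "opt_value f g = (INF x. objective f g x)"

definition composite_problem ::
    "(real ^ 'n \<Rightarrow> ereal) \<Rightarrow> (real ^ 'n \<Rightarrow> ereal) \<Rightarrow> bool" where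
  "composite_problem f g \<longleftrightarrow>
     proper_fun g \<and> closed_convex_fun g \<and> standard_self_concordant f \<and>
     continuous_on (edom (objective f g)) (hessian (real_part f)) \<and>
     (\<forall>x\<in>edom (objective f g). positive_definite (hessian (real_part f) x)) \<and>
     (\<exists>!x. is_arg_min (objective f g) (\<lambda>_. True) x)"

definition pn_direction ::
    "(real ^ 'n \<Rightarrow> ereal) \<Rightarrow> (real ^ 'n \<Rightarrow> ereal) \<Rightarrow> real ^ 'n \<Rightarrow> real ^ 'n" where
  "pn_direction f g x = arg_min
     (\<lambda>d. f x + ereal (gradient (real_part f) x \<bullet> d)
            + ereal (1/2 * (d \<bullet> (hessian (real_part f) x *v d))) + g (x + d))
     (\<lambda>_. True)"

definition newton_direction :: "(real ^ 'n \<Rightarrow> ereal) \<Rightarrow> real ^ 'n \<Rightarrow> real ^ 'n" where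
  "newton_direction f x =
     - (matrix_inv (hessian (real_part f) x) *v gradient (real_part f) x)"

definition local_norm :: "(real ^ 'n \<Rightarrow> ereal) \<Rightarrow> real ^ 'n \<Rightarrow> real ^ 'n \<Rightarrow> real" where
  "local_norm f x d = sqrt (d \<bullet> (hessian (real_part f) x *v d))"

definition damped_step ::
    "(real ^ 'n \<Rightarrow> ereal) \<Rightarrow> (real ^ 'n \<Rightarrow> real ^ 'n) \<Rightarrow> real ^ 'n \<Rightarrow> real ^ 'n" where
  "damped_step f dir x = x + (1 / (1 + local_norm f x (dir x))) *\<^sub>R dir x"

definition pdn_iter ::
    "(real ^ 'n \<Rightarrow> ereal) \<Rightarrow> (real ^ 'n \<Rightarrow> ereal) \<Rightarrow> real ^ 'n \<Rightarrow> nat \<Rightarrow> real ^ 'n" where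
  "pdn_iter f g x0 k = (damped_step f (pn_direction f g) ^^ k) x0"

definition dn_iter :: "(real ^ 'n \<Rightarrow> ereal) \<Rightarrow> real ^ 'n \<Rightarrow> nat \<Rightarrow> real ^ 'n" where
  "dn_iter f x0 k = (damped_step f (newton_direction f) ^^ k) x0"

end

theory Submission
  imports Defs
begin

text \<open>
  The proof combines a guaranteed decrease per step with an error bound, both in terms of the local
  norm \<open>l\<close> of the search direction \<open>d\<close> at the current iterate \<open>x\<close>. Let \<open>\<Delta>\<close> be the optimality gap at \<open>x\<close>.

  Decrease. Along the segment from \<open>x\<close> in direction \<open>d\<close>, self-concordance controls how fast the second
  derivative of \<open>f\<close> can grow, so \<open>f\<close> lies below an explicit function with a logarithmic barrier term.
  Together with the optimality of \<open>d\<close> for the subproblem and the convexity of \<open>g\<close>, the damped step stays in the domain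
  and decreases the objective by at least \<open>l - ln (1 + l)\<close> (\<open>damped_step_decrease\<close>). In particular the
  iterates stay in the initial sublevel set \<open>S\<close>, and \<open>l\<close> is bounded there, so that the decrease is at
  least a multiple of \<open>l\<^sup>2\<close>.

  Error bound. The set \<open>S\<close> is compact (\<open>compact_S\<close>), hence the Hessian of \<open>f\<close> has uniform positive bounds
  \<open>m\<close> and \<open>M\<close> on \<open>S\<close>, and the gradient of the objective is Lipschitz continuous on \<open>S\<close>. Comparing \<open>d\<close> with a short move
  towards the minimizer shows that the subproblem predicts a decrease of at least a multiple of \<open>\<Delta>\<close>;
  on the other hand the predicted decrease is at most the norm of the gradient times that of \<open>d\<close>, which is of
  the order of \<open>sqrt \<Delta> l\<close>. Hence \<open>\<Delta>\<close> is at most a multiple of \<open>l\<^sup>2\<close> (\<open>error_bound\<close>).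

  So each step removes a fixed fraction of the gap (\<open>linear_convergence\<close>). The argument uses only
  that the directions solve the subproblem. This holds for the proximal Newton direction, because the subproblem
  has a solution at every point of \<open>S\<close>, and for \<open>g = 0\<close> also for the Newton direction.
\<close>

section \<open>Closed convex extended-valued functions\<close>

lemma ereal_real_part:
  assumes "\<And>y. h y \<noteq> -\<infinity>" and "x \<in> edom h"
  shows "h x = ereal (real_part h x)"
  using assms(1)[of x] assms(2) by (cases "h x") (auto simp: edom_def real_part_def)

text \<open>The sublevel set is the slice of the epigraph at height \<open>a\<close>. This is the form in which lower
  semicontinuity is used below.\<close>

lemma closed_sublevel:
  assumes h: "\<And>y. h y \<noteq> -\<infinity>" and cl: "closed (epigraph (edom h) (real_part h))"
  shows "closed {x. h x \<le> ereal a}"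
proof -
  have "{x. h x \<le> ereal a} = (\<lambda>x. (x, a)) -` epigraph (edom h) (real_part h)"
  proof (intro set_eqI iffI)
    fix x assume "x \<in> {x. h x \<le> ereal a}"
    hence le: "h x \<le> ereal a" and d: "x \<in> edom h"
      by (auto simp: edom_def intro: le_less_trans)
    thus "x \<in> (\<lambda>x. (x, a)) -` epigraph (edom h) (real_part h)"
      using ereal_real_part[OF h d] by (simp add: mem_epigraph)
  next
    fix x assume "x \<in> (\<lambda>x. (x, a)) -` epigraph (edom h) (real_part h)"
    hence d: "x \<in> edom h" and "real_part h x \<le> a" by (auto simp: mem_epigraph)
    thus "x \<in> {x. h x \<le> ereal a}" using ereal_real_part[OF h d] by simp
  qed
  moreover have "continuous_on UNIV (\<lambda>x. (x, a))" by (intro continuous_intros)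
  ultimately show ?thesis using cl closed_vimage by metis
qed

text \<open>The sum exceeds \<open>c\<close> exactly if \<open>c\<close> splits into two real numbers that are exceeded by the two
  summands, so the complement is a union of open sets, also where a summand is infinite.\<close>

lemma closed_sublevel_add:
  assumes h: "\<And>y. h y \<noteq> -\<infinity>" "closed (epigraph (edom h) (real_part h))"
      and k: "\<And>y. k y \<noteq> -\<infinity>" "closed (epigraph (edom k) (real_part k))"
  shows "closed {x. h x + k x \<le> ereal c}"
proof -
  have "- {x. h x + k x \<le> ereal c} = (\<Union>a. {x. ereal a < h x} \<inter> {x. ereal (c - a) < k x})" (is "?L = ?R")
  proof (intro set_eqI iffI)
    fix x assume "x \<in> ?L"
    hence gt: "ereal c < h x + k x" by auto
    show "x \<in> ?R"
    proof (cases "h x"; cases "k x")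
      fix r s assume rs: "h x = ereal r" "k x = ereal s"
      then have "c < r + s" using gt by simp
      then have "x \<in> {x. ereal ((r + (c - s))/2) < h x} \<inter> {x. ereal (c - (r + (c - s))/2) < k x}"
        using rs by (auto simp: field_simps)
      thus ?thesis by blast
    next
      fix r assume rs: "h x = ereal r" "k x = \<infinity>"
      then have "x \<in> {x. ereal (r - 1) < h x} \<inter> {x. ereal (c - (r - 1)) < k x}" by auto
      thus ?thesis by blast
    next
      fix s assume rs: "h x = \<infinity>" "k x = ereal s"
      then have "x \<in> {x. ereal (c - (s - 1)) < h x} \<inter> {x. ereal (c - (c - (s - 1))) < k x}" by auto
      thus ?thesis by blast
    next
      assume rs: "h x = \<infinity>" "k x = \<infinity>"
      then have "x \<in> {x. ereal 0 < h x} \<inter> {x. ereal (c - 0) < k x}" by auto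
      thus ?thesis by blast
    qed (use h(1) k(1) in auto)
  next
    fix x assume "x \<in> ?R"
    then obtain a where "ereal a < h x" "ereal (c - a) < k x" by auto
    hence "ereal a + ereal (c - a) < h x + k x" by (rule ereal_add_strict_mono2)
    thus "x \<in> ?L" by auto
  qed
  moreover have "open ?R"
  proof (intro open_UN ballI open_Int)
    fix a :: real
    have "{x. ereal a < h x} = - {x. h x \<le> ereal a}" by auto
    thus "open {x. ereal a < h x}" using closed_sublevel[OF h, of a] by (simp add: open_Compl)
    have "{x. ereal (c - a) < k x} = - {x. k x \<le> ereal (c - a)}" by auto
    thus "open {x. ereal (c - a) < k x}" using closed_sublevel[OF k, of "c - a"] by (simp add: open_Compl)
  qed
  ultimately show ?thesis by (simp add: closed_def)
qed

section \<open>Calculus on the real line\<close>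

text \<open>With \<open>\<phi>\<close> the difference of a function and an explicit comparison function, this turns a bound on
  second derivatives into a bound on values. It yields both the quadratic lower bound of strong convexity
  and the logarithmic upper bound of self-concordance.\<close>

lemma second_derivative_nonpos_imp_below_tangent:
  fixes \<phi> :: "real \<Rightarrow> real"
  assumes "0 \<le> T"
    and d1: "\<And>t. 0 \<le> t \<Longrightarrow> t \<le> T \<Longrightarrow> (\<phi> has_real_derivative \<phi>1 t) (at t)"
    and d2: "\<And>t. 0 \<le> t \<Longrightarrow> t \<le> T \<Longrightarrow> (\<phi>1 has_real_derivative \<phi>2 t) (at t)"
    and np: "\<And>t. 0 \<le> t \<Longrightarrow> t \<le> T \<Longrightarrow> \<phi>2 t \<le> 0"
  shows "\<phi> T \<le> \<phi> 0 + T * \<phi>1 0"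
proof -
  have le: "\<phi>1 t \<le> \<phi>1 0" if "0 \<le> t" "t \<le> T" for t
    by (rule DERIV_nonpos_imp_nonincreasing[OF that(1)]) (use d2 np that in force)
  have "\<phi> T - T * \<phi>1 0 \<le> \<phi> 0 - 0 * \<phi>1 0"
  proof (rule DERIV_nonpos_imp_nonincreasing[OF \<open>0 \<le> T\<close>])
    fix t assume t: "0 \<le> t" "t \<le> T"
    have "((\<lambda>t. \<phi> t - t * \<phi>1 0) has_real_derivative (\<phi>1 t - \<phi>1 0)) (at t)"
      by (auto intro!: derivative_eq_intros d1 t)
    thus "\<exists>y. ((\<lambda>t. \<phi> t - t * \<phi>1 0) has_real_derivative y) (at t) \<and> y \<le> 0"
      using le[OF t] by auto
  qed
  thus ?thesis by simp
qed

text \<open>Convexity bounds a function along a segment by a linear function of the parameter;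
  this extracts the first-order inequality at the start of the segment.\<close>

lemma derivative_le_if_below_line:
  fixes \<phi> :: "real \<Rightarrow> real"
  assumes der: "(\<phi> has_real_derivative D) (at 0)"
    and le: "\<And>t. 0 < t \<Longrightarrow> t \<le> 1 \<Longrightarrow> \<phi> t \<le> \<phi> 0 + t * K"
  shows "D \<le> K"
proof (rule ccontr)
  assume "\<not> D \<le> K"
  moreover have "((\<lambda>t. \<phi> t - t * K) has_real_derivative (D - K)) (at 0)"
    by (auto intro!: derivative_eq_intros der)
  ultimately obtain d where d: "0 < d" "\<forall>h>0. h < d \<longrightarrow> \<phi> 0 - 0 * K < \<phi> (0 + h) - (0 + h) * K"
    using DERIV_pos_inc_right[of "\<lambda>t. \<phi> t - t * K" "D - K" 0] by auto
  define t where "t = min 1 (d / 2)"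
  have "0 < t" "t \<le> 1" "t < d" using d(1) by (auto simp: t_def)
  thus False using d(2) le[of t] by auto
qed

text \<open>The damped step decreases the objective by at least \<open>l - ln (1 + l)\<close>, where \<open>l\<close> is the local norm of the
  direction. The bound shows that this is of the order of \<open>l\<^sup>2\<close> as long as \<open>l\<close> stays bounded.\<close>

lemma ln_add_one_le_self_minus_quadratic:
  fixes x :: real
  assumes "0 \<le> x"
  shows "x\<^sup>2 / (2 * (1 + x)) \<le> x - ln (1 + x)"
proof -
  have "(ln (1 + x) - x + x\<^sup>2 / (2 * (1 + x))) \<le> (ln (1 + 0) - 0 + 0\<^sup>2 / (2 * (1 + 0)))"
  proof (rule DERIV_nonpos_imp_nonincreasing[OF assms])
    fix t :: real assume "0 \<le> t" "t \<le> x"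
    have "((\<lambda>x. ln (1 + x) - x + x\<^sup>2 / (2 * (1 + x))) has_real_derivative
        (1 / (1 + t) - 1 + (2 * t * (2 * (1 + t)) - t\<^sup>2 * 2) / (2 * (1 + t))\<^sup>2)) (at t)"
      using \<open>0 \<le> t\<close> by (auto intro!: derivative_eq_intros simp: power2_eq_square)
    moreover have "1 / (1 + t) - 1 + (2 * t * (2 * (1 + t)) - t\<^sup>2 * 2) / (2 * (1 + t))\<^sup>2
        = - (t\<^sup>2 / (2 * (1 + t)\<^sup>2))"
      using \<open>0 \<le> t\<close> by (simp add: divide_simps) (simp add: power2_eq_square algebra_simps)
    ultimately show "\<exists>y. ((\<lambda>x. ln (1 + x) - x + x\<^sup>2 / (2 * (1 + x))) has_real_derivative y) (at t) \<and> y \<le> 0"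
      by (intro exI[of _ "- (t\<^sup>2 / (2 * (1 + t)\<^sup>2))"]) auto
  qed
  thus ?thesis by simp
qed

text \<open>The hypothesis \<open>\<bar>p'\<bar> \<le> 2 p\<^bsup>3/2\<^esup>\<close> says that \<open>p\<^bsup>-1/2\<^esup>\<close> has slope between
  \<open>-1\<close> and \<open>1\<close>. Starting from \<open>1 / l\<close> it is therefore at least \<open>1 / l - t\<close> at time \<open>t\<close>, which is the
  claim after taking the power \<open>-2\<close>.\<close>

lemma self_concordant_growth:
  fixes p p' :: "real \<Rightarrow> real"
  assumes "0 \<le> t" and "0 \<le> l" and p0: "p 0 = l\<^sup>2" and tl: "t * l < 1"
    and pos: "\<And>s. 0 \<le> s \<Longrightarrow> s \<le> t \<Longrightarrow> 0 < p s"
    and der: "\<And>s. 0 \<le> s \<Longrightarrow> s \<le> t \<Longrightarrow> (p has_real_derivative p' s) (at s)"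
    and sc: "\<And>s. 0 \<le> s \<Longrightarrow> s \<le> t \<Longrightarrow> \<bar>p' s\<bar> \<le> 2 * p s powr (3/2)"
  shows "p t \<le> l\<^sup>2 / (1 - t * l)\<^sup>2"
proof -
  have p0': "0 < p 0" and pt: "0 < p t" using pos assms(1) by auto
  hence l: "0 < l" using p0 assms(2) by (cases "l = 0") auto
  define r :: real where "r = - (1/2)"
  have "- (p t powr r) - t \<le> - (p 0 powr r) - 0"
  proof (rule DERIV_nonpos_imp_nonincreasing[OF \<open>0 \<le> t\<close>])
    fix s assume s: "0 \<le> s" "s \<le> t"
    have "((\<lambda>s. p s powr r) has_real_derivative r * p s powr (r - of_nat 1) * p' s) (at s)"
      by (rule DERIV_fun_powr[OF der[OF s] pos[OF s]])
    hence "((\<lambda>s. - (p s powr r) - s) has_real_derivative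
        - (r * p s powr (r - of_nat 1) * p' s) - 1) (at s)"
      by (intro DERIV_diff DERIV_minus DERIV_ident)
    moreover have "- (r * p s powr (r - of_nat 1) * p' s) - 1 \<le> 0"
    proof -
      define P where "P = p s powr (r - of_nat 1)"
      have "P * p' s \<le> P * (2 * p s powr (3/2))"
        using sc[OF s] by (intro mult_left_mono) (auto simp: P_def)
      also have "\<dots> = 2 * p s powr (r - of_nat 1 + 3/2)"
        unfolding P_def by (subst powr_add) (rule mult.left_commute)
      also have "r - of_nat 1 + 3/2 = 0" by (simp add: r_def)
      also have "2 * p s powr 0 = 2" using pos[OF s] by simp
      finally show ?thesis unfolding P_def[symmetric] by (simp add: r_def)
    qed
    ultimately show "\<exists>y. ((\<lambda>s. - (p s powr r) - s) has_real_derivative y) (at s) \<and> y \<le> 0" by blast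
  qed
  moreover have "q powr r = 1 / sqrt q" if "0 < q" for q
    unfolding r_def powr_minus powr_half_sqrt[OF less_imp_le[OF that]] by (rule inverse_eq_divide)
  moreover have "sqrt (p 0) = l" using l by (simp add: p0)
  ultimately have "1 / l - t \<le> 1 / sqrt (p t)" using pt p0' by simp
  moreover have "1 / l - t = (1 - t * l) / l" using l by (simp add: diff_divide_distrib)
  ultimately have "(1 - t * l) / l \<le> 1 / sqrt (p t)" by (simp only:)
  hence "sqrt (p t) \<le> l / (1 - t * l)" using pt l tl by (simp add: divide_simps mult.commute)
  hence "(sqrt (p t))\<^sup>2 \<le> (l / (1 - t * l))\<^sup>2" using pt by (intro power_mono) auto
  thus ?thesis using pt by (simp add: power_divide)
qed

section \<open>Gradients and Hessians\<close>

lemma gradient_works: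
  fixes h :: "real ^ 'n \<Rightarrow> real"
  assumes "h differentiable (at x)"
  shows "(h has_derivative (\<lambda>d. d \<bullet> gradient h x)) (at x)"
proof -
  from assms obtain L where L: "(h has_derivative L) (at x)" by (auto simp: differentiable_def)
  hence "linear L" by (rule has_derivative_linear)
  hence "L = (\<lambda>d. d \<bullet> adjoint L 1)" by (simp add: adjoint_works fun_eq_iff)
  with L have G: "GDERIV h x :> adjoint L 1" by (simp add: gderiv_def)
  have "GDERIV h x :> gradient h x" unfolding gradient_def
  proof (rule theI[of "\<lambda>D. GDERIV h x :> D", OF G])
    fix D assume "GDERIV h x :> D"
    hence "(\<lambda>d. d \<bullet> D) = (\<lambda>d. d \<bullet> adjoint L 1)"
      using G unfolding gderiv_def by (rule has_derivative_unique)
    thus "D = adjoint L 1" by (metis vector_eq_ldot)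
  qed
  thus ?thesis by (simp add: gderiv_def)
qed

lemma gradient_eqI:
  fixes h :: "real ^ 'n \<Rightarrow> real"
  assumes "(h has_derivative (\<lambda>d. d \<bullet> D)) (at x)"
  shows "gradient h x = D"
proof -
  have "(\<lambda>d. d \<bullet> gradient h x) = (\<lambda>d. d \<bullet> D)"
    using gradient_works[of h x] assms by (metis has_derivative_unique differentiableI)
  thus ?thesis by (metis vector_eq_ldot)
qed

lemma frechet_derivative_eq_gradient:
  fixes h :: "real ^ 'n \<Rightarrow> real"
  assumes "h differentiable (at x)"
  shows "frechet_derivative h (at x) v = v \<bullet> gradient h x"
  by (metis assms frechet_derivative_at gradient_works)

text \<open>The components of the gradient are directional derivatives, whose differentiability is what
  \<^const>\<open>times_cont_diff_on\<close> provides.\<close>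

lemma hessian_works:
  fixes h :: "real ^ 'n \<Rightarrow> real"
  assumes "open U" "times_cont_diff_on 3 h U" "x \<in> U"
  shows "(gradient h has_derivative (\<lambda>d. hessian h x *v d)) (at x)"
proof -
  have h: "h differentiable (at y)" if "y \<in> U" for y
    using assms(2) that by (simp add: eval_nat_numeral)
  have D: "(\<lambda>y. frechet_derivative h (at y) v) differentiable (at y)" if "y \<in> U" for v y
    using assms(2) that by (simp add: eval_nat_numeral)
  have "(\<lambda>y. gradient h y \<bullet> i) differentiable (at x)" for i
  proof -
    from D[OF \<open>x \<in> U\<close>, of i] obtain L where
      "((\<lambda>y. frechet_derivative h (at y) i) has_derivative L) (at x)"
      by (auto simp: differentiable_def)
    hence "((\<lambda>y. gradient h y \<bullet> i) has_derivative L) (at x)"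
      using assms(1,3) by (rule has_derivative_transform_within_open)
        (simp add: frechet_derivative_eq_gradient h inner_commute)
    thus ?thesis by (auto simp: differentiable_def)
  qed
  hence "gradient h differentiable (at x)"
    by (subst differentiable_componentwise_within) blast
  thus ?thesis unfolding hessian_def by (subst (asm) jacobian_works)
qed

lemma frechet_derivative_directional:
  fixes h :: "real ^ 'n \<Rightarrow> real"
  assumes "open U" "times_cont_diff_on 3 h U" "x \<in> U"
  shows "frechet_derivative (\<lambda>y. frechet_derivative h (at y) d) (at x) d = d \<bullet> (hessian h x *v d)"
proof -
  have "((\<lambda>y. d \<bullet> gradient h y) has_derivative (\<lambda>v. d \<bullet> (hessian h x *v v))) (at x)"
    by (rule has_derivative_inner_right[OF hessian_works[OF assms]])
  hence "((\<lambda>y. frechet_derivative h (at y) d) has_derivative (\<lambda>v. d \<bullet> (hessian h x *v v))) (at x)"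
    using assms(1,3)
  proof (rule has_derivative_transform_within_open)
    fix y assume "y \<in> U"
    thus "d \<bullet> gradient h y = frechet_derivative h (at y) d"
      using assms(2) by (subst frechet_derivative_eq_gradient) (simp_all add: eval_nat_numeral)
  qed
  thus ?thesis by (metis frechet_derivative_at)
qed

lemma hessian_form_differentiable:
  fixes h :: "real ^ 'n \<Rightarrow> real"
  assumes "open U" "times_cont_diff_on 3 h U" "x \<in> U"
  shows "(\<lambda>y. d \<bullet> (hessian h y *v d)) differentiable (at x)"
proof -
  have "(\<lambda>z. frechet_derivative (\<lambda>y. frechet_derivative h (at y) d) (at z) d) differentiable (at x)"
    using assms(2,3) by (simp add: eval_nat_numeral)
  then obtain L where
    "((\<lambda>z. frechet_derivative (\<lambda>y. frechet_derivative h (at y) d) (at z) d) has_derivative L) (at x)"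
    by (auto simp: differentiable_def)
  hence "((\<lambda>y. d \<bullet> (hessian h y *v d)) has_derivative L) (at x)"
    using assms(1,3) by (rule has_derivative_transform_within_open)
      (simp add: frechet_derivative_directional[OF assms(1,2)])
  thus ?thesis by (auto simp: differentiable_def)
qed

lemma has_real_derivative_along_line:
  fixes k :: "'a::real_normed_vector \<Rightarrow> real"
  assumes "(k has_derivative k') (at (x + t *\<^sub>R d))"
  shows "((\<lambda>t. k (x + t *\<^sub>R d)) has_real_derivative k' d) (at t)"
proof -
  have "((\<lambda>t. x + t *\<^sub>R d) has_derivative (\<lambda>s. s *\<^sub>R d)) (at t)"
    by (auto intro!: derivative_eq_intros)
  from has_derivative_compose[OF this assms]
  have "((\<lambda>t. k (x + t *\<^sub>R d)) has_derivative (\<lambda>s. k' (s *\<^sub>R d))) (at t)" .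
  moreover have "k' (s *\<^sub>R d) = k' d * s" for s
    using has_derivative_linear[OF assms] by (simp add: linear_cmul)
  ultimately show ?thesis by (simp add: has_field_derivative_def)
qed

lemma derivatives_along_line:
  fixes h :: "real ^ 'n \<Rightarrow> real"
  assumes "open U" "times_cont_diff_on 3 h U" "x + t *\<^sub>R d \<in> U"
  shows "((\<lambda>t. h (x + t *\<^sub>R d)) has_real_derivative d \<bullet> gradient h (x + t *\<^sub>R d)) (at t)"
    and "((\<lambda>t. d \<bullet> gradient h (x + t *\<^sub>R d)) has_real_derivative
            d \<bullet> (hessian h (x + t *\<^sub>R d) *v d)) (at t)"
    and "((\<lambda>t. d \<bullet> (hessian h (x + t *\<^sub>R d) *v d)) has_real_derivative
            frechet_derivative (\<lambda>y. d \<bullet> (hessian h y *v d)) (at (x + t *\<^sub>R d)) d) (at t)"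
proof -
  have "h differentiable (at (x + t *\<^sub>R d))"
    using assms(2,3) by (simp add: eval_nat_numeral)
  from has_real_derivative_along_line[OF gradient_works[OF this]]
  show "((\<lambda>t. h (x + t *\<^sub>R d)) has_real_derivative d \<bullet> gradient h (x + t *\<^sub>R d)) (at t)" .
  have "((\<lambda>y. d \<bullet> gradient h y) has_derivative
      (\<lambda>v. d \<bullet> (hessian h (x + t *\<^sub>R d) *v v))) (at (x + t *\<^sub>R d))"
    by (rule has_derivative_inner_right[OF hessian_works[OF assms]])
  from has_real_derivative_along_line[OF this]
  show "((\<lambda>t. d \<bullet> gradient h (x + t *\<^sub>R d)) has_real_derivative
            d \<bullet> (hessian h (x + t *\<^sub>R d) *v d)) (at t)" .
  show "((\<lambda>t. d \<bullet> (hessian h (x + t *\<^sub>R d) *v d)) has_real_derivative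
            frechet_derivative (\<lambda>y. d \<bullet> (hessian h y *v d)) (at (x + t *\<^sub>R d)) d) (at t)"
    by (rule has_real_derivative_along_line)
      (rule hessian_form_differentiable[OF assms, THEN frechet_derivative_works[THEN iffD1]])
qed

text \<open>The defining inequality of self-concordance speaks about iterated derivatives at \<open>0\<close> of the
  restriction \<open>\<psi>\<close> to a line. On the open set of parameters whose points lie in the domain, the first two
  derivatives of \<open>\<psi>\<close> are expressed by gradient and Hessian; the third is then the derivative of the
  Hessian form.\<close>

lemma self_concordant_third_derivative:
  fixes f :: "real ^ 'n \<Rightarrow> ereal"
  assumes sc: "standard_self_concordant f" and x: "x \<in> edom f"
  shows "\<bar>frechet_derivative (\<lambda>y. d \<bullet> (hessian (real_part f) y *v d)) (at x) d\<bar>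
    \<le> 2 * (d \<bullet> (hessian (real_part f) x *v d)) powr (3/2)"
proof -
  let ?h = "real_part f"
  define \<psi> where "\<psi> = (\<lambda>t::real. ?h (x + t *\<^sub>R d))"
  have U: "open (edom f)" "times_cont_diff_on 3 ?h (edom f)"
    using sc by (auto simp: standard_self_concordant_def)
  define W where "W = (\<lambda>t::real. x + t *\<^sub>R d) -` edom f"
  have W: "open W" unfolding W_def using U(1) by (intro open_vimage continuous_intros)
  have 0: "0 \<in> W" using x by (simp add: W_def)
  have d1: "deriv \<psi> t = d \<bullet> gradient ?h (x + t *\<^sub>R d)" if "t \<in> W" for t
    unfolding \<psi>_def using that by (intro DERIV_imp_deriv derivatives_along_line[OF U]) (simp add: W_def)
  have d2: "deriv (deriv \<psi>) t = d \<bullet> (hessian ?h (x + t *\<^sub>R d) *v d)" if "t \<in> W" for t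
  proof -
    have "deriv (deriv \<psi>) t = deriv (\<lambda>t. d \<bullet> gradient ?h (x + t *\<^sub>R d)) t"
      using eventually_nhds_in_open[OF W that] by (intro deriv_cong_ev) (auto elim!: eventually_mono simp: d1)
    also have "\<dots> = d \<bullet> (hessian ?h (x + t *\<^sub>R d) *v d)"
      using that by (intro DERIV_imp_deriv derivatives_along_line[OF U]) (simp add: W_def)
    finally show ?thesis .
  qed
  have d3: "deriv (deriv (deriv \<psi>)) 0
      = frechet_derivative (\<lambda>y. d \<bullet> (hessian ?h y *v d)) (at (x + 0 *\<^sub>R d)) d"
  proof -
    have "deriv (deriv (deriv \<psi>)) 0 = deriv (\<lambda>t. d \<bullet> (hessian ?h (x + t *\<^sub>R d) *v d)) 0"
      using eventually_nhds_in_open[OF W 0] by (intro deriv_cong_ev) (auto elim!: eventually_mono simp: d2)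
    also have "\<dots> = frechet_derivative (\<lambda>y. d \<bullet> (hessian ?h y *v d)) (at (x + 0 *\<^sub>R d)) d"
      using 0 by (intro DERIV_imp_deriv derivatives_along_line[OF U]) (simp add: W_def)
    finally show ?thesis .
  qed
  have "\<bar>(deriv ^^ 3) \<psi> 0\<bar> \<le> 2 * ((deriv ^^ 2) \<psi> 0) powr (3/2)"
    using sc x unfolding standard_self_concordant_def Let_def \<psi>_def by blast
  thus ?thesis using d2[OF 0] d3 by (simp add: eval_nat_numeral)
qed

lemma convex_above_gradient_plane:
  fixes h :: "real ^ 'n \<Rightarrow> real"
  assumes cv: "convex_on S h" and h: "h differentiable (at x)" and "x \<in> S" "y \<in> S"
  shows "h x + (y - x) \<bullet> gradient h x \<le> h y"
proof -
  have "(y - x) \<bullet> gradient h x \<le> h y - h x"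
  proof (rule derivative_le_if_below_line)
    show "((\<lambda>t. h (x + t *\<^sub>R (y - x))) has_real_derivative (y - x) \<bullet> gradient h x) (at 0)"
      by (rule has_real_derivative_along_line) (simp add: gradient_works h)
  next
    fix t :: real assume t: "0 < t" "t \<le> 1"
    have "x + t *\<^sub>R (y - x) = (1 - t) *\<^sub>R x + t *\<^sub>R y" by (simp add: algebra_simps)
    thus "h (x + t *\<^sub>R (y - x)) \<le> h (x + 0 *\<^sub>R (y - x)) + t * (h y - h x)"
      using convex_onD[OF cv, of t x y] t assms(3,4) by (simp add: algebra_simps)
  qed
  thus ?thesis by simp
qed

text \<open>Along the segment the second derivative of \<open>h\<close> dominates that of a parabola.\<close>

lemma strongly_convex_lower_bound:
  fixes h :: "real ^ 'n \<Rightarrow> real"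
  assumes U: "open U" "times_cont_diff_on 3 h U"
    and seg: "\<And>t. 0 \<le> t \<Longrightarrow> t \<le> 1 \<Longrightarrow> x + t *\<^sub>R e \<in> U"
    and m: "\<And>t. 0 \<le> t \<Longrightarrow> t \<le> 1 \<Longrightarrow>
      m * (norm e)\<^sup>2 \<le> e \<bullet> (hessian h (x + t *\<^sub>R e) *v e)"
  shows "h x + e \<bullet> gradient h x + m / 2 * (norm e)\<^sup>2 \<le> h (x + e)"
proof -
  have "(1\<^sup>2 * (m / 2 * (norm e)\<^sup>2) - h (x + 1 *\<^sub>R e))
      \<le> (0\<^sup>2 * (m / 2 * (norm e)\<^sup>2) - h (x + 0 *\<^sub>R e))
        + 1 * (2 * 0 * (m / 2 * (norm e)\<^sup>2) - e \<bullet> gradient h (x + 0 *\<^sub>R e))"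
  proof (rule second_derivative_nonpos_imp_below_tangent)
    fix t :: real assume t: "0 \<le> t" "t \<le> 1"
    note D = derivatives_along_line[OF U seg[OF t]]
    show "((\<lambda>t. t\<^sup>2 * (m / 2 * (norm e)\<^sup>2) - h (x + t *\<^sub>R e)) has_real_derivative
        2 * t * (m / 2 * (norm e)\<^sup>2) - e \<bullet> gradient h (x + t *\<^sub>R e)) (at t)"
      by (auto intro!: derivative_eq_intros D)
    show "((\<lambda>t. 2 * t * (m / 2 * (norm e)\<^sup>2) - e \<bullet> gradient h (x + t *\<^sub>R e)) has_real_derivative
        m * (norm e)\<^sup>2 - e \<bullet> (hessian h (x + t *\<^sub>R e) *v e)) (at t)"
      by (auto intro!: derivative_eq_intros D)
    show "m * (norm e)\<^sup>2 - e \<bullet> (hessian h (x + t *\<^sub>R e) *v e) \<le> 0" using m[OF t] by simp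
  qed simp
  thus ?thesis by simp
qed

text \<open>The form and the norm are homogeneous in \<open>v\<close> and continuous on the compact product of \<open>K\<close> with the
  unit sphere, where the form attains a positive minimum.\<close>

lemma hessian_bounds_on_compact:
  fixes H :: "real ^ 'n \<Rightarrow> real ^ 'n ^ 'n"
  assumes "compact K" and "K \<noteq> {}" and cont: "continuous_on K H"
    and pd: "\<And>x. x \<in> K \<Longrightarrow> positive_definite (H x)"
  obtains m M where "0 < m" "m \<le> M"
    "\<And>x v. x \<in> K \<Longrightarrow> m * (norm v)\<^sup>2 \<le> v \<bullet> (H x *v v)"
    "\<And>x v. x \<in> K \<Longrightarrow> norm (H x *v v) \<le> M * norm v"
proof -
  let ?S = "K \<times> sphere (0 :: real ^ 'n) 1"
  have ne: "?S \<noteq> {}" using assms(2) by auto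
  have co: "compact ?S" using assms(1) by (intro compact_Times compact_sphere)
  have cv: "continuous_on ?S (\<lambda>(x, v). H x *v v)"
    unfolding split_beta matrix_vector_mult_def
    by (intro continuous_intros continuous_on_compose2[OF cont]) auto
  have cq: "continuous_on ?S (\<lambda>(x, v). v \<bullet> (H x *v v))"
    using cv unfolding split_beta by (intro continuous_intros)
  obtain z where z: "z \<in> ?S" "\<And>y. y \<in> ?S \<Longrightarrow> (\<lambda>(x, v). v \<bullet> (H x *v v)) z \<le> (\<lambda>(x, v). v \<bullet> (H x *v v)) y"
    using continuous_attains_inf[OF co ne cq] by blast
  define m where "m = (\<lambda>(x, v). v \<bullet> (H x *v v)) z"
  obtain B where B: "\<And>y. y \<in> ?S \<Longrightarrow> norm ((\<lambda>(x, v). H x *v v) y) \<le> B"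
    using compact_imp_bounded[OF compact_continuous_image[OF cv co]] unfolding bounded_iff by blast
  have m0: "0 < m"
  proof -
    obtain x v where xv: "z = (x, v)" "x \<in> K" "norm v = 1" using z(1) by auto
    hence "v \<noteq> 0" by auto
    thus ?thesis using pd[OF xv(2)] by (simp add: m_def xv(1) positive_definite_def)
  qed
  have lo: "m * (norm v)\<^sup>2 \<le> v \<bullet> (H x *v v)" if "x \<in> K" for x v
  proof (cases "v = 0")
    case False
    have "m \<le> (v /\<^sub>R norm v) \<bullet> (H x *v (v /\<^sub>R norm v))"
      using z(2)[of "(x, v /\<^sub>R norm v)"] that False by (simp add: m_def)
    also have "\<dots> = v \<bullet> (H x *v v) / (norm v)\<^sup>2"
      by (simp add: matrix_vector_mult_scaleR power2_eq_square divide_inverse)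
    finally show ?thesis using False by (simp add: pos_le_divide_eq)
  qed simp
  have up: "norm (H x *v v) \<le> B * norm v" if "x \<in> K" for x v
  proof (cases "v = 0")
    case False
    have "norm (H x *v (v /\<^sub>R norm v)) \<le> B"
      using B[of "(x, v /\<^sub>R norm v)"] that False by simp
    thus ?thesis using False by (simp add: matrix_vector_mult_scaleR divide_simps mult.commute)
  qed simp
  have "m \<le> max m B" by simp
  moreover have "norm (H x *v v) \<le> max m B * norm v" if "x \<in> K" for x v
    using up[OF that, of v] by (smt (verit) mult_right_mono norm_ge_zero)
  ultimately show thesis using that m0 lo by blast
qed

section \<open>Descent of a self-concordant function along a damped step\<close>

text \<open>The quadratic form \<open>p s\<close> of the Hessian at \<open>x + s d\<close> is the second derivative of \<open>f\<close> along the line. By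
  the preceding growth estimate it is at most \<open>l\<^sup>2 / (1 - s l)\<^sup>2\<close>, the second derivative of
  \<open>- s l - ln (1 - s l)\<close>; integrating twice gives the bound wherever the segment stays in the domain. The
  segment cannot leave the domain: the bound keeps \<open>f\<close> below a constant \<open>B\<close>, so the set of admissible
  parameters is closed, as a preimage of a sublevel set, and open, as a preimage of the domain.

  Positivity of the form is only asked for along the segment, because the Hessian is known to be
  definite only on the common domain of \<open>f\<close> and \<open>g\<close>.\<close>

lemma self_concordant_upper_bound:
  fixes f :: "real ^ 'n \<Rightarrow> ereal"
  assumes sc: "standard_self_concordant f" and x: "x \<in> edom f"
    and t: "0 \<le> t" and l: "0 \<le> l" "l\<^sup>2 = d \<bullet> (hessian (real_part f) x *v d)" "t * l < 1"
    and pos: "\<And>s. 0 \<le> s \<Longrightarrow> s \<le> t \<Longrightarrow> x + s *\<^sub>R d \<in> edom f \<Longrightarrow>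
      0 < d \<bullet> (hessian (real_part f) (x + s *\<^sub>R d) *v d)"
  shows "x + t *\<^sub>R d \<in> edom f"
    and "real_part f (x + t *\<^sub>R d)
      \<le> real_part f x + t * (d \<bullet> gradient (real_part f) x) - t * l - ln (1 - t * l)"
proof -
  let ?h = "real_part f"
  define a where "a = d \<bullet> gradient ?h x"
  have U: "open (edom f)" "times_cont_diff_on 3 ?h (edom f)"
    and cv: "convex_on (edom f) ?h" and cl: "closed (epigraph (edom f) ?h)" and ninf: "\<And>y. f y \<noteq> -\<infinity>"
    using sc by (auto simp: standard_self_concordant_def closed_convex_fun_def)
  have lt1: "r * l < 1" if "r \<le> t" for r
    using mult_right_mono[OF that l(1)] l(3) by linarith
  have bound: "?h (x + s *\<^sub>R d) \<le> ?h x + s * a - s * l - ln (1 - s * l)"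
    if s: "0 \<le> s" "s \<le> t" and sd: "x + s *\<^sub>R d \<in> edom f" for s
  proof -
    have seg: "x + r *\<^sub>R d \<in> edom f" if "0 \<le> r" "r \<le> s" for r
    proof (cases "s = 0")
      case True
      then show ?thesis using that x by simp
    next
      case False
      have "x + r *\<^sub>R d = (1 - r / s) *\<^sub>R x + (r / s) *\<^sub>R (x + s *\<^sub>R d)"
        using False by (simp add: algebra_simps)
      moreover have "(1 - r / s) *\<^sub>R x + (r / s) *\<^sub>R (x + s *\<^sub>R d) \<in> edom f"
        using that False s(1) by (intro convexD[OF convex_on_imp_convex[OF cv] x sd]) auto
      ultimately show ?thesis by simp
    qed
    have growth: "d \<bullet> (hessian ?h (x + r *\<^sub>R d) *v d) \<le> l\<^sup>2 / (1 - r * l)\<^sup>2"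
      if r: "0 \<le> r" "r \<le> s" for r
    proof (rule self_concordant_growth[OF r(1) l(1)])
      show "d \<bullet> (hessian ?h (x + 0 *\<^sub>R d) *v d) = l\<^sup>2" by (simp add: l(2))
      show "r * l < 1" using r s by (intro lt1) simp
      fix u assume u: "0 \<le> u" "u \<le> r"
      show "0 < d \<bullet> (hessian ?h (x + u *\<^sub>R d) *v d)" using u r s seg by (intro pos) auto
      show "((\<lambda>t. d \<bullet> (hessian ?h (x + t *\<^sub>R d) *v d)) has_real_derivative
            frechet_derivative (\<lambda>y. d \<bullet> (hessian ?h y *v d)) (at (x + u *\<^sub>R d)) d) (at u)"
        using u r seg by (intro derivatives_along_line(3)[OF U]) auto
      show "\<bar>frechet_derivative (\<lambda>y. d \<bullet> (hessian ?h y *v d)) (at (x + u *\<^sub>R d)) d\<bar>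
          \<le> 2 * (d \<bullet> (hessian ?h (x + u *\<^sub>R d) *v d)) powr (3/2)"
        using u r seg by (intro self_concordant_third_derivative[OF sc]) auto
    qed
    have "?h (x + s *\<^sub>R d) + s * l + ln (1 - s * l)
      \<le> ?h (x + 0 *\<^sub>R d) + 0 * l + ln (1 - 0 * l)
        + s * (d \<bullet> gradient ?h (x + 0 *\<^sub>R d) + l - l / (1 - 0 * l))"
    proof (rule second_derivative_nonpos_imp_below_tangent[OF s(1)])
      fix r assume r: "0 \<le> r" "r \<le> s"
      have rl: "r * l < 1" using r s by (intro lt1) simp
      note D = derivatives_along_line[OF U seg[OF r]]
      show "((\<lambda>s. ?h (x + s *\<^sub>R d) + s * l + ln (1 - s * l)) has_real_derivative
          d \<bullet> gradient ?h (x + r *\<^sub>R d) + l - l / (1 - r * l)) (at r)"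
        using rl by (auto intro!: derivative_eq_intros D)
      have "((\<lambda>s. d \<bullet> gradient ?h (x + s *\<^sub>R d) + l - l / (1 - s * l)) has_real_derivative
          d \<bullet> (hessian ?h (x + r *\<^sub>R d) *v d) + 0 - (0 * (1 - r * l) - l * (0 - l)) / ((1 - r * l) * (1 - r * l))) (at r)"
        using rl by (auto intro!: derivative_eq_intros D)
      thus "((\<lambda>s. d \<bullet> gradient ?h (x + s *\<^sub>R d) + l - l / (1 - s * l)) has_real_derivative
          d \<bullet> (hessian ?h (x + r *\<^sub>R d) *v d) - l\<^sup>2 / (1 - r * l)\<^sup>2) (at r)"
        by (simp add: power2_eq_square)
      show "d \<bullet> (hessian ?h (x + r *\<^sub>R d) *v d) - l\<^sup>2 / (1 - r * l)\<^sup>2 \<le> 0"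
        using growth[OF r] by simp
    qed
    thus ?thesis by (simp add: a_def)
  qed
  define B where "B = ?h x + t * \<bar>a\<bar> - ln (1 - t * l)"
  define A where "A = {0..t} \<inter> (\<lambda>s. x + s *\<^sub>R d) -` edom f"
  have A_alt: "A = {0..t} \<inter> (\<lambda>s. x + s *\<^sub>R d) -` {y. f y \<le> ereal B}"
  proof (intro set_eqI iffI)
    fix s assume "s \<in> A"
    hence s: "0 \<le> s" "s \<le> t" "x + s *\<^sub>R d \<in> edom f" by (auto simp: A_def)
    have "s * a \<le> s * \<bar>a\<bar>" using s by (intro mult_left_mono) auto
    also have "\<dots> \<le> t * \<bar>a\<bar>" using s by (intro mult_right_mono) auto
    finally have "s * a \<le> t * \<bar>a\<bar>" .
    moreover have "ln (1 - t * l) \<le> ln (1 - s * l)"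
      using mult_right_mono[OF s(2) l(1)] l(3) by simp
    moreover have "0 \<le> s * l" using s l by simp
    ultimately have "?h (x + s *\<^sub>R d) \<le> B" using bound[OF s] unfolding B_def by linarith
    thus "s \<in> {0..t} \<inter> (\<lambda>s. x + s *\<^sub>R d) -` {y. f y \<le> ereal B}"
      using s ereal_real_part[OF ninf s(3)] by simp
  next
    fix s assume "s \<in> {0..t} \<inter> (\<lambda>s. x + s *\<^sub>R d) -` {y. f y \<le> ereal B}"
    thus "s \<in> A" by (auto simp: A_def edom_def intro: le_less_trans)
  qed
  have "openin (top_of_set {0..t}) A"
    unfolding A_def using U(1) by (intro openin_open_Int open_vimage continuous_intros)
  moreover have "closedin (top_of_set {0..t}) A"
    unfolding A_alt by (intro closedin_closed_Int closed_vimage closed_sublevel[OF ninf cl] continuous_intros)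
  moreover have "connected {0..t}" by simp
  ultimately have "A = {} \<or> A = {0..t}" unfolding connected_clopen by blast
  moreover have "0 \<in> A" using x t by (simp add: A_def)
  ultimately have "t \<in> A" using t by auto
  thus td: "x + t *\<^sub>R d \<in> edom f" by (simp add: A_def)
  show "?h (x + t *\<^sub>R d) \<le> ?h x + t * (d \<bullet> gradient ?h x) - t * l - ln (1 - t * l)"
    using bound[OF t order_refl td] by (simp add: a_def)
qed

section \<open>The proximal Newton subproblem\<close>

text \<open>The term \<open>f x\<close> of the subproblem is constant in \<open>d\<close> and left out. The value is meaningful for
  \<open>x + d\<close> in the domain of \<open>g\<close> only.\<close>

definition pn_model :: "(real ^ 'n \<Rightarrow> ereal) \<Rightarrow> (real ^ 'n \<Rightarrow> ereal) \<Rightarrow> real ^ 'n \<Rightarrow> real ^ 'n \<Rightarrow> real" where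
  "pn_model f g x d = gradient (real_part f) x \<bullet> d + 1/2 * (d \<bullet> (hessian (real_part f) x *v d))
     + real_part g (x + d)"

text \<open>A predicate rather than a chosen minimizer: both the direction selected by
  \<^const>\<open>pn_direction\<close> and the explicit \<^const>\<open>newton_direction\<close> satisfy it, and the convergence proof
  uses nothing else about a direction.\<close>

definition solves_subproblem ::
    "(real ^ 'n \<Rightarrow> ereal) \<Rightarrow> (real ^ 'n \<Rightarrow> ereal) \<Rightarrow> real ^ 'n \<Rightarrow> real ^ 'n \<Rightarrow> bool" where
  "solves_subproblem f g x d \<longleftrightarrow> x + d \<in> edom g \<and>
     (\<forall>d'. x + d' \<in> edom g \<longrightarrow> pn_model f g x d \<le> pn_model f g x d')"

lemma is_arg_min_iff_solves_subproblem:
  fixes f g :: "real ^ 'n \<Rightarrow> ereal"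
  assumes f: "\<And>y. f y \<noteq> -\<infinity>" and g: "\<And>y. g y \<noteq> -\<infinity>" and x: "x \<in> edom f" "x \<in> edom g"
  shows "is_arg_min (\<lambda>d. f x + ereal (gradient (real_part f) x \<bullet> d)
            + ereal (1/2 * (d \<bullet> (hessian (real_part f) x *v d))) + g (x + d)) (\<lambda>_. True) d
    \<longleftrightarrow> solves_subproblem f g x d" (is "is_arg_min ?q _ d \<longleftrightarrow> _")
proof -
  have q: "?q d = ereal (real_part f x + pn_model f g x d)" if "x + d \<in> edom g" for d
    unfolding ereal_real_part[OF f x(1)] ereal_real_part[OF g that] by (simp add: pn_model_def)
  have q_inf: "?q d = \<infinity>" if "x + d \<notin> edom g" for d
    using that unfolding ereal_real_part[OF f x(1)] by (simp add: edom_def)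
  have 0: "x + 0 \<in> edom g" using x by simp
  show ?thesis unfolding is_arg_min_linorder solves_subproblem_def
  proof (intro iffI conjI allI impI TrueI)
    assume "True \<and> (\<forall>y. True \<longrightarrow> ?q d \<le> ?q y)"
    hence min: "?q d \<le> ?q y" for y by blast
    show d: "x + d \<in> edom g"
    proof (rule ccontr)
      assume "x + d \<notin> edom g"
      from min[of 0] show False unfolding q_inf[OF \<open>x + d \<notin> edom g\<close>] q[OF 0] by simp
    qed
    fix d' assume "x + d' \<in> edom g"
    from min[of d'] show "pn_model f g x d \<le> pn_model f g x d'"
      unfolding q[OF d] q[OF \<open>x + d' \<in> edom g\<close>] by simp
  next
    fix y
    assume "x + d \<in> edom g \<and> (\<forall>d'. x + d' \<in> edom g \<longrightarrow> pn_model f g x d \<le> pn_model f g x d')"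
    hence d: "x + d \<in> edom g" and min: "\<And>d'. x + d' \<in> edom g \<Longrightarrow> pn_model f g x d \<le> pn_model f g x d'"
      by auto
    show "?q d \<le> ?q y"
    proof (cases "x + y \<in> edom g")
      case True
      show ?thesis unfolding q[OF d] q[OF True] using min[OF True] by simp
    next
      case False
      show ?thesis unfolding q_inf[OF False] by simp
    qed
  qed
qed

text \<open>Minimizing \<open>c + h\<close> is minimizing the continuous function \<open>c y + r\<close> over the points \<open>(y, r)\<close> of the
  closed epigraph of \<open>h\<close>. Only points of value at most \<open>c x + h x\<close> matter. For these, \<open>y\<close> lies in a compact
  set because of the minorant \<open>a\<close>, and \<open>r\<close> lies between bounds of \<open>a\<close> and of \<open>- c\<close> on that set.\<close>

lemma attains_min_above_coercive_minorant:
  fixes h :: "'a::euclidean_space \<Rightarrow> ereal" and c a :: "'a \<Rightarrow> real"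
  assumes h: "\<And>y. h y \<noteq> -\<infinity>" "closed (epigraph (edom h) (real_part h))"
    and c: "continuous_on UNIV c" and a: "continuous_on UNIV a"
    and minorant: "\<And>y. y \<in> edom h \<Longrightarrow> a y \<le> real_part h y"
    and x: "x \<in> edom h" and bdd: "bounded {y. c y + a y \<le> c x + real_part h x}"
  obtains z where "z \<in> edom h" "\<And>y. y \<in> edom h \<Longrightarrow> c z + real_part h z \<le> c y + real_part h y"
proof -
  define \<alpha> where "\<alpha> = c x + real_part h x"
  define B where "B = {y. c y + a y \<le> \<alpha>}"
  have "closed B" unfolding B_def by (intro closed_Collect_le continuous_intros c a)
  with bdd have B: "compact B" by (simp add: B_def \<alpha>_def compact_eq_bounded_closed)
  obtain r where r: "\<And>y. y \<in> B \<Longrightarrow> norm (a y) \<le> r"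
    using compact_imp_bounded[OF compact_continuous_image[OF continuous_on_subset[OF a] B]]
    unfolding bounded_iff by auto
  obtain s where s: "\<And>y. y \<in> B \<Longrightarrow> norm (c y) \<le> s"
    using compact_imp_bounded[OF compact_continuous_image[OF continuous_on_subset[OF c] B]]
    unfolding bounded_iff by auto
  define K where "K = (B \<times> {- r .. \<alpha> + s}) \<inter> (epigraph (edom h) (real_part h)
      \<inter> {p. c (fst p) + snd p \<le> \<alpha>})"
  have cp: "continuous_on UNIV (\<lambda>p :: 'a \<times> real. c (fst p) + snd p)"
    by (intro continuous_intros continuous_on_compose2[OF c]) auto
  have "compact K" unfolding K_def
    by (intro compact_Int_closed compact_Times B compact_Icc closed_Int h(2) closed_Collect_le cp continuous_intros)
  moreover have in_K: "(y, real_part h y) \<in> K" if y: "y \<in> edom h" "c y + real_part h y \<le> \<alpha>" for y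
  proof -
    have "y \<in> B" using minorant[OF y(1)] y(2) by (simp add: B_def)
    moreover from this have "- r \<le> real_part h y" "real_part h y \<le> \<alpha> + s"
      using r[of y] s[of y] minorant[OF y(1)] y(2) by (auto simp: abs_le_iff)
    ultimately show ?thesis using y by (simp add: K_def mem_epigraph)
  qed
  moreover have "(x, real_part h x) \<in> K" using x by (intro in_K) (simp_all add: \<alpha>_def)
  ultimately obtain p where p: "p \<in> K" "\<And>p'. p' \<in> K \<Longrightarrow> c (fst p) + snd p \<le> c (fst p') + snd p'"
    using continuous_attains_inf[of K "\<lambda>p. c (fst p) + snd p"] continuous_on_subset[OF cp, of K] by blast
  have z: "fst p \<in> edom h" "real_part h (fst p) \<le> snd p" "c (fst p) + snd p \<le> \<alpha>"
    using p(1) by (auto simp: K_def mem_epigraph epigraph_def)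
  show thesis
  proof (rule that[OF z(1)])
    fix y assume y: "y \<in> edom h"
    show "c (fst p) + real_part h (fst p) \<le> c y + real_part h y"
    proof (cases "c y + real_part h y \<le> \<alpha>")
      case True
      from p(2)[OF in_K[OF y True]] z(2) show ?thesis by simp
    next
      case False
      with z show ?thesis by linarith
    qed
  qed
qed

text \<open>The tangent plane of \<open>g\<close> at \<open>x\<close> is a minorant of \<open>g\<close>, and the positive definite quadratic term makes
  its sum with the smooth part of the model coercive.\<close>

lemma subproblem_solution_exists:
  fixes f g :: "real ^ 'n \<Rightarrow> ereal"
  assumes g: "\<And>y. g y \<noteq> -\<infinity>" "closed_convex_fun g"
    and x: "x \<in> edom g" "real_part g differentiable (at x)"
    and pd: "positive_definite (hessian (real_part f) x)"
  shows "\<exists>d. solves_subproblem f g x d"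
proof -
  let ?G = "gradient (real_part f) x" and ?H = "hessian (real_part f) x" and ?v = "gradient (real_part g) x"
  define c where "c = (\<lambda>y. ?G \<bullet> (y - x) + 1/2 * ((y - x) \<bullet> (?H *v (y - x))))"
  define a where "a = (\<lambda>y. real_part g x + (y - x) \<bullet> ?v)"
  have cl: "closed (epigraph (edom g) (real_part g))" and cv: "convex_on (edom g) (real_part g)"
    using g(2) by (auto simp: closed_convex_fun_def)
  have "\<exists>m>0. \<forall>v. m * (norm v)\<^sup>2 \<le> v \<bullet> (?H *v v)"
  proof (rule hessian_bounds_on_compact[of "{x}" "hessian (real_part f)"])
    show "\<And>z. z \<in> {x} \<Longrightarrow> positive_definite (hessian (real_part f) z)" using pd by simp
  qed auto
  then obtain m where m: "0 < m" "\<And>v. m * (norm v)\<^sup>2 \<le> v \<bullet> (?H *v v)" by blast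
  have cc: "continuous_on UNIV c"
    unfolding c_def matrix_vector_mult_def by (intro continuous_intros)
  have ca: "continuous_on UNIV a"
    unfolding a_def by (intro continuous_intros)
  have mn: "\<And>y. y \<in> edom g \<Longrightarrow> a y \<le> real_part g y"
    unfolding a_def using convex_above_gradient_plane[OF cv x(2) x(1)] .
  have "{y. c y + a y \<le> c x + real_part g x} \<subseteq> cball x (2 * norm (?G + ?v) / m)"
  proof
    fix y assume "y \<in> {y. c y + a y \<le> c x + real_part g x}"
    hence "(y - x) \<bullet> (?G + ?v) + 1/2 * ((y - x) \<bullet> (?H *v (y - x))) \<le> 0"
      by (simp add: c_def a_def inner_add_right inner_commute)
    moreover have "- (norm (y - x) * norm (?G + ?v)) \<le> (y - x) \<bullet> (?G + ?v)"
      using Cauchy_Schwarz_ineq2[of "y - x" "?G + ?v"] by linarith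
    ultimately have "m * (norm (y - x))\<^sup>2 \<le> 2 * (norm (y - x) * norm (?G + ?v))"
      using m(2)[of "y - x"] by linarith
    hence "m * norm (y - x) * norm (y - x) \<le> 2 * norm (?G + ?v) * norm (y - x)"
      by (simp only: power2_eq_square mult_ac)
    hence "m * norm (y - x) \<le> 2 * norm (?G + ?v)" by (cases "y = x") auto
    thus "y \<in> cball x (2 * norm (?G + ?v) / m)"
      using m(1) by (simp add: dist_norm norm_minus_commute field_simps)
  qed
  hence "bounded {y. c y + a y \<le> c x + real_part g x}" by (rule bounded_subset[OF bounded_cball])
  then obtain z where z: "z \<in> edom g" "\<And>y. y \<in> edom g \<Longrightarrow> c z + real_part g z \<le> c y + real_part g y"
    using attains_min_above_coercive_minorant[OF g(1) cl cc ca mn x(1)] by blast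
  have "solves_subproblem f g x (z - x)"
    unfolding solves_subproblem_def pn_model_def using z(1) z(2)[of "x + _"] by (simp add: c_def)
  thus ?thesis by blast
qed

text \<open>Completing the square: the model exceeds its value at the Newton direction by half the Hessian
  form of the difference.\<close>

lemma newton_direction_solves_subproblem:
  fixes f :: "real ^ 'n \<Rightarrow> ereal"
  assumes pd: "positive_definite (hessian (real_part f) x)"
  shows "solves_subproblem f (\<lambda>_. 0) x (newton_direction f x)"
proof -
  let ?G = "gradient (real_part f) x" and ?H = "hessian (real_part f) x"
  define d where "d = newton_direction f x"
  have "?H *v v = 0 \<Longrightarrow> v = 0" for v
    using pd unfolding positive_definite_def by (metis inner_zero_right less_irrefl)
  hence "inj ((*v) ?H)" by (simp add: linear_injective_0)
  hence "invertible ?H"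
    using matrix_left_invertible_injective invertible_left_inverse by blast
  hence "?H ** matrix_inv ?H = mat 1"
    unfolding invertible_def matrix_inv_def by (metis (mono_tags, lifting) someI_ex)
  hence Hd: "?H *v d = - ?G"
    by (simp add: d_def newton_direction_def matrix_vector_mul_assoc vec.neg)
  have sym: "u \<bullet> (?H *v v) = v \<bullet> (?H *v u)" for u v
    using pd unfolding positive_definite_def
    by (metis dot_lmul_matrix inner_commute transpose_matrix_vector)
  have "pn_model f (\<lambda>_. 0) x d \<le> pn_model f (\<lambda>_. 0) x d'" for d'
  proof -
    have "0 \<le> (d' - d) \<bullet> (?H *v (d' - d))"
      using pd unfolding positive_definite_def by (cases "d' - d = 0") (auto intro: less_imp_le)
    also have "\<dots> = d' \<bullet> (?H *v d') - 2 * (d' \<bullet> (?H *v d)) + d \<bullet> (?H *v d)"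
      using sym[of d d'] by (simp add: matrix_vector_mult_diff_distrib inner_diff_left inner_diff_right)
    finally show ?thesis by (simp add: pn_model_def Hd inner_commute real_part_def)
  qed
  thus ?thesis by (simp add: solves_subproblem_def d_def edom_def)
qed

text \<open>Comparing \<open>d\<close> with \<open>(1 - s) d\<close> in the model, and estimating \<open>g\<close> there by convexity, leaves after
  division by \<open>s\<close> the claim up to a term that vanishes as \<open>s\<close> tends to \<open>0\<close>.\<close>

lemma subproblem_decrease:
  fixes f g :: "real ^ 'n \<Rightarrow> ereal"
  assumes sol: "solves_subproblem f g x d" and cv: "convex_on (edom g) (real_part g)" and x: "x \<in> edom g"
  shows "d \<bullet> gradient (real_part f) x + d \<bullet> (hessian (real_part f) x *v d) + real_part g (x + d)
    \<le> real_part g x"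
proof -
  let ?G = "gradient (real_part f) x" and ?H = "hessian (real_part f) x" and ?g = "real_part g"
  define Q where "Q = d \<bullet> (?H *v d)"
  have xd: "x + d \<in> edom g" using sol by (simp add: solves_subproblem_def)
  have "Q \<le> - (d \<bullet> ?G + ?g (x + d) - ?g x)"
  proof (rule derivative_le_if_below_line)
    show "((\<lambda>s. - (1/2 * (1 - s)\<^sup>2 * Q)) has_real_derivative Q) (at 0)"
      by (auto intro!: derivative_eq_intros)
    fix s :: real assume s: "0 < s" "s \<le> 1"
    have e: "x + (1 - s) *\<^sub>R d = (1 - (1 - s)) *\<^sub>R x + (1 - s) *\<^sub>R (x + d)" by (simp add: algebra_simps)
    have "x + (1 - s) *\<^sub>R d \<in> edom g"
      unfolding e using s by (intro convexD[OF convex_on_imp_convex[OF cv] x xd]) auto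
    hence "pn_model f g x d \<le> pn_model f g x ((1 - s) *\<^sub>R d)"
      using sol by (simp add: solves_subproblem_def)
    moreover have "?g (x + (1 - s) *\<^sub>R d) \<le> (1 - (1 - s)) * ?g x + (1 - s) * ?g (x + d)"
      unfolding e using s by (intro convex_onD[OF cv]) (auto simp: x xd)
    ultimately have "d \<bullet> ?G + 1/2 * Q + ?g (x + d)
        \<le> (1 - s) * (d \<bullet> ?G) + 1/2 * ((1 - s)\<^sup>2 * Q) + (s * ?g x + (1 - s) * ?g (x + d))"
      by (simp add: pn_model_def Q_def matrix_vector_mult_scaleR power2_eq_square inner_commute)
    thus "- (1/2 * (1 - s)\<^sup>2 * Q) \<le> - (1/2 * (1 - 0)\<^sup>2 * Q) + s * - (d \<bullet> ?G + ?g (x + d) - ?g x)"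
      by (simp add: algebra_simps)
  qed
  thus ?thesis by (simp add: Q_def)
qed

text \<open>With step size \<open>t\<close>, self-concordance bounds \<open>f\<close>, convexity bounds \<open>g\<close>, and the preceding lemma bounds the
  sum of the first-order terms by \<open>- t l\<^sup>2\<close>. Altogether the objective changes by at most
  \<open>- t l\<^sup>2 - t l - ln (1 - t l)\<close>, and the step size \<open>1 / (1 + l)\<close> minimizes this expression.\<close>

lemma damped_step_decrease:
  fixes f g :: "real ^ 'n \<Rightarrow> ereal"
  assumes sc: "standard_self_concordant f" and cv: "convex_on (edom g) (real_part g)"
    and pd: "\<And>y. y \<in> edom f \<Longrightarrow> y \<in> edom g \<Longrightarrow> positive_definite (hessian (real_part f) y)"
    and x: "x \<in> edom f" "x \<in> edom g" and sol: "solves_subproblem f g x (dir x)"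
  defines "l \<equiv> local_norm f x (dir x)"
  shows "damped_step f dir x \<in> edom f" "damped_step f dir x \<in> edom g"
    and "real_part f (damped_step f dir x) + real_part g (damped_step f dir x)
      \<le> real_part f x + real_part g x - (l - ln (1 + l))"
proof -
  let ?f = "real_part f" and ?g = "real_part g"
  define d where "d = dir x"
  define Q where "Q = d \<bullet> (hessian ?f x *v d)"
  have Q: "0 \<le> Q" using pd[OF x] unfolding Q_def positive_definite_def
    by (cases "d = 0") (auto intro: less_imp_le)
  have l: "0 \<le> l" "l\<^sup>2 = Q" using Q by (auto simp: l_def local_norm_def Q_def d_def)
  define t where "t = 1 / (1 + l)"
  have t: "0 \<le> t" "t \<le> 1" "t * l < 1" "t * (1 + l) = 1" using l(1) by (auto simp: t_def)
  have step: "damped_step f dir x = x + t *\<^sub>R d"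
    by (simp add: damped_step_def t_def l_def d_def)
  have xd: "x + d \<in> edom g" using sol by (simp add: solves_subproblem_def d_def)
  have e: "x + s *\<^sub>R d = (1 - s) *\<^sub>R x + s *\<^sub>R (x + d)" for s by (simp add: algebra_simps)
  \<comment> \<open>Since the step size is at most \<open>1\<close>, convexity keeps the step in the domain of \<open>g\<close>.\<close>
  have gdom: "x + s *\<^sub>R d \<in> edom g" if "0 \<le> s" "s \<le> 1" for s
    unfolding e using that by (intro convexD[OF convex_on_imp_convex[OF cv] x(2) xd]) auto
  show "damped_step f dir x \<in> edom g" unfolding step using t by (intro gdom)
  have "damped_step f dir x \<in> edom f \<and>
    ?f (damped_step f dir x) + ?g (damped_step f dir x) \<le> ?f x + ?g x - (l - ln (1 + l))"
  proof (cases "d = 0")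
    case True
    hence "l = 0" using l by (simp add: Q_def)
    thus ?thesis unfolding step using True x by simp
  next
    case False
    have pos: "0 < d \<bullet> (hessian ?f (x + s *\<^sub>R d) *v d)"
      if "0 \<le> s" "s \<le> t" "x + s *\<^sub>R d \<in> edom f" for s
      using pd[OF that(3) gdom] that t False by (auto simp: positive_definite_def)
    note ub = self_concordant_upper_bound[OF sc x(1) t(1) l(1) l(2)[unfolded Q_def] t(3) pos]
    have gt: "?g (x + t *\<^sub>R d) \<le> (1 - t) * ?g x + t * ?g (x + d)"
      unfolding e using t by (intro convex_onD[OF cv]) (auto simp: x xd)
    have "t * (d \<bullet> gradient ?f x + l\<^sup>2 + ?g (x + d)) \<le> t * ?g x"
      using subproblem_decrease[OF sol cv x(2)] t l(2) unfolding Q_def d_def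
      by (intro mult_left_mono) auto
    moreover have e1: "1 - t * l = t" using t(4) by (simp add: algebra_simps)
    moreover have "ln t = - ln (1 + l)" using l(1) by (simp add: t_def ln_div)
    moreover have "t * l\<^sup>2 + t * l = l" using t(4) by (metis distrib_left mult.assoc mult.commute mult_1 power2_eq_square add.commute mult.right_neutral)
    ultimately have "?f (x + t *\<^sub>R d) + ?g (x + t *\<^sub>R d) \<le> ?f x + ?g x - (l - ln (1 + l))"
      using ub(2)[unfolded e1] gt by (simp add: algebra_simps)
    thus ?thesis using ub(1) by (simp add: step)
  qed
  thus "damped_step f dir x \<in> edom f"
    "?f (damped_step f dir x) + ?g (damped_step f dir x) \<le> ?f x + ?g x - (l - ln (1 + l))" by auto
qed

section \<open>Sublevel sets of the composite objective\<close>

text \<open>\<open>xs\<close> is the minimizer; \<open>S\<close> below is the initial sublevel set, in which all iterates will lie.\<close>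

locale smooth_composite_problem =
  fixes f g :: "real ^ 'n \<Rightarrow> ereal" and x0 xs :: "real ^ 'n"
  assumes problem: "composite_problem f g"
    and x0: "x0 \<in> edom (objective f g)"
    and smooth: "lipschitz_differentiable_on g {x. objective f g x \<le> objective f g x0}"
    and xs_min: "\<And>x. objective f g xs \<le> objective f g x"
begin

text \<open>The real value of the objective, meaningful on the common domain of \<open>f\<close> and \<open>g\<close> only.\<close>

definition F :: "real ^ 'n \<Rightarrow> real" where
  "F x = real_part f x + real_part g x"

definition S :: "(real ^ 'n) set" where
  "S = {x. objective f g x \<le> objective f g x0}"

lemma f_not_MInf: "f x \<noteq> -\<infinity>"
  and g_not_MInf: "g x \<noteq> -\<infinity>"
  and sc: "standard_self_concordant f"
  and ccg: "closed_convex_fun g"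
  and cvx_f: "convex_on (edom f) (real_part f)"
  and cvx_g: "convex_on (edom g) (real_part g)"
  and cl_f: "closed (epigraph (edom f) (real_part f))"
  and cl_g: "closed (epigraph (edom g) (real_part g))"
  and open_f: "open (edom f)"
  and C3_f: "times_cont_diff_on 3 (real_part f) (edom f)"
  using problem
  by (auto simp: composite_problem_def standard_self_concordant_def closed_convex_fun_def proper_fun_def)

lemma edom_objective: "edom (objective f g) = edom f \<inter> edom g"
  using f_not_MInf g_not_MInf by (auto simp: edom_def objective_def)

lemma objective_eq:
  assumes "x \<in> edom f" "x \<in> edom g"
  shows "objective f g x = ereal (F x)"
  unfolding objective_def ereal_real_part[OF f_not_MInf assms(1)] ereal_real_part[OF g_not_MInf assms(2)]
  by (simp add: F_def)

lemma hessian_pd: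
  assumes "x \<in> edom f" "x \<in> edom g"
  shows "positive_definite (hessian (real_part f) x)"
  using problem assms edom_objective by (auto simp: composite_problem_def)

lemma hessian_cont: "continuous_on (edom f \<inter> edom g) (hessian (real_part f))"
  using problem edom_objective by (simp add: composite_problem_def)

lemma x0_dom: "x0 \<in> edom f" "x0 \<in> edom g"
  using x0 edom_objective by auto

lemma S_dom: assumes "x \<in> S" shows "x \<in> edom f" "x \<in> edom g"
proof -
  have "objective f g x < \<infinity>"
    using assms x0 unfolding S_def edom_def by (auto intro: le_less_trans)
  hence "x \<in> edom (objective f g)" by (simp add: edom_def)
  thus "x \<in> edom f" "x \<in> edom g" using edom_objective by auto
qed

lemma mem_S_iff: "x \<in> S \<longleftrightarrow> x \<in> edom f \<and> x \<in> edom g \<and> F x \<le> F x0"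
proof (cases "x \<in> edom f \<and> x \<in> edom g")
  case True
  thus ?thesis by (simp add: S_def objective_eq x0_dom)
next
  case False
  thus ?thesis using S_dom by blast
qed

lemma x0_S: "x0 \<in> S" by (simp add: S_def)

lemma xs_S: "xs \<in> S" by (simp add: S_def xs_min)

lemma F_min: "x \<in> edom f \<Longrightarrow> x \<in> edom g \<Longrightarrow> F xs \<le> F x"
  using xs_min[of x] by (simp add: objective_eq S_dom xs_S)

lemma g_interior: "x \<in> S \<Longrightarrow> x \<in> interior (edom g)"
  and g_diff: "x \<in> S \<Longrightarrow> real_part g differentiable (at x)"
  using smooth by (auto simp: lipschitz_differentiable_on_def S_def)

lemma f_diff: "x \<in> edom f \<Longrightarrow> real_part f differentiable (at x)"
  using C3_f by (simp add: eval_nat_numeral)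

lemma convex_dom: "convex (edom f \<inter> edom g)"
  by (intro convex_Int convex_on_imp_convex[OF cvx_f] convex_on_imp_convex[OF cvx_g])

lemma F_convex: "convex_on (edom f \<inter> edom g) F"
  unfolding F_def
  by (intro convex_on_add convex_on_subset[OF cvx_f] convex_on_subset[OF cvx_g] convex_dom) auto

lemma convex_S: "convex S"
proof -
  have "S = {x \<in> edom f \<inter> edom g. F x \<le> F x0}" by (auto simp: mem_S_iff)
  also have "convex \<dots>" unfolding convex_alt
  proof (intro ballI allI impI)
    fix x y u assume x: "x \<in> {x \<in> edom f \<inter> edom g. F x \<le> F x0}"
      and y: "y \<in> {x \<in> edom f \<inter> edom g. F x \<le> F x0}" and u: "0 \<le> (u::real) \<and> u \<le> 1"
    have "F ((1 - u) *\<^sub>R x + u *\<^sub>R y) \<le> (1 - u) * F x + u * F y"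
      using x y u by (intro convex_onD[OF F_convex]) auto
    also have "\<dots> \<le> (1 - u) * F x0 + u * F x0"
      using x y u by (intro add_mono mult_left_mono) auto
    also have "\<dots> = F x0" by (simp add: algebra_simps)
    finally have "F ((1 - u) *\<^sub>R x + u *\<^sub>R y) \<le> F x0" .
    moreover have "(1 - u) *\<^sub>R x + u *\<^sub>R y \<in> edom f \<inter> edom g"
      using x y u by (intro convexD[OF convex_dom]) auto
    ultimately show "(1 - u) *\<^sub>R x + u *\<^sub>R y \<in> {x \<in> edom f \<inter> edom g. F x \<le> F x0}" by simp
  qed
  finally show ?thesis .
qed

text \<open>The minimizer lies in the initial sublevel set, hence in the interior of the domain of \<open>g\<close>, where
  both summands are differentiable.\<close>

lemma stationary: "gradient (real_part f) xs + gradient (real_part g) xs = 0"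
proof -
  let ?v = "gradient (real_part f) xs + gradient (real_part g) xs"
  have "((\<lambda>y. real_part f y + real_part g y) has_derivative
      (\<lambda>d. d \<bullet> gradient (real_part f) xs + d \<bullet> gradient (real_part g) xs)) (at xs)"
    by (intro has_derivative_add gradient_works f_diff g_diff S_dom xs_S)
  hence "(F has_derivative (\<lambda>d. d \<bullet> ?v)) (at xs)" by (simp add: F_def[abs_def] inner_add_right)
  moreover have "xs \<in> edom f \<inter> interior (edom g)" using S_dom g_interior xs_S by blast
  moreover have "open (edom f \<inter> interior (edom g))" using open_f by auto
  moreover have "\<forall>y \<in> edom f \<inter> interior (edom g). F xs \<le> F y"
    using F_min interior_subset by blast
  ultimately have "(\<lambda>d. d \<bullet> ?v) = (\<lambda>d. 0)" by (metis differential_zero_maxmin)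
  hence "?v \<bullet> ?v = 0" by meson
  thus ?thesis by simp
qed

text \<open>\<open>f\<close> exceeds its tangent plane at \<open>xs\<close> by a quadratic term, \<open>g\<close> lies above its tangent plane, and the two
  slopes cancel.\<close>

lemma quadratic_growth:
  assumes K: "convex K" "K \<subseteq> edom f \<inter> edom g" "xs \<in> K" "x \<in> K"
    and m: "\<And>y v. y \<in> K \<Longrightarrow> m * (norm v)\<^sup>2 \<le> v \<bullet> (hessian (real_part f) y *v v)"
  shows "F xs + m / 2 * (norm (x - xs))\<^sup>2 \<le> F x"
proof -
  have seg: "xs + t *\<^sub>R (x - xs) \<in> K" if "0 \<le> t" "t \<le> 1" for t
  proof -
    have "xs + t *\<^sub>R (x - xs) = (1 - t) *\<^sub>R xs + t *\<^sub>R x" by (simp add: algebra_simps)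
    also have "\<dots> \<in> K" using that K by (intro convexD) auto
    finally show ?thesis .
  qed
  have "real_part f xs + (x - xs) \<bullet> gradient (real_part f) xs + m / 2 * (norm (x - xs))\<^sup>2
      \<le> real_part f (xs + (x - xs))"
    using seg K(2) by (intro strongly_convex_lower_bound[OF open_f C3_f] m) auto
  moreover have "real_part g xs + (x - xs) \<bullet> gradient (real_part g) xs \<le> real_part g x"
    using K by (intro convex_above_gradient_plane[OF cvx_g] g_diff xs_S) auto
  moreover have "(x - xs) \<bullet> gradient (real_part f) xs + (x - xs) \<bullet> gradient (real_part g) xs = 0"
    using stationary by (metis inner_add_right inner_zero_right)
  ultimately show ?thesis by (simp add: F_def)
qed

text \<open>Near the minimizer the Hessian is uniformly definite, so the objective exceeds the optimal value by a
  fixed amount on a small sphere around \<open>xs\<close>. By convexity along rays from \<open>xs\<close> the excess grows at least linearly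
  outside the sphere, which bounds the sublevel set.\<close>

lemma compact_S: "compact S"
proof -
  have "open (edom f \<inter> interior (edom g))" using open_f by auto
  moreover have "xs \<in> edom f \<inter> interior (edom g)" using S_dom g_interior xs_S by blast
  ultimately obtain r where r: "0 < r" "cball xs r \<subseteq> edom f \<inter> interior (edom g)"
    by (meson open_contains_cball)
  hence K: "cball xs r \<subseteq> edom f \<inter> edom g" using interior_subset by blast
  have "\<exists>m>0. \<forall>y\<in>cball xs r. \<forall>v. m * (norm v)\<^sup>2 \<le> v \<bullet> (hessian (real_part f) y *v v)"
  proof (rule hessian_bounds_on_compact[of "cball xs r" "hessian (real_part f)"])
    show "continuous_on (cball xs r) (hessian (real_part f))"
      by (rule continuous_on_subset[OF hessian_cont K])
    show "\<And>y. y \<in> cball xs r \<Longrightarrow> positive_definite (hessian (real_part f) y)"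
      using K by (intro hessian_pd) auto
  qed (use r(1) in auto)
  then obtain m where m: "0 < m"
    "\<And>y v. y \<in> cball xs r \<Longrightarrow> m * (norm v)\<^sup>2 \<le> v \<bullet> (hessian (real_part f) y *v v)" by blast
  define R where "R = max r (2 * (F x0 - F xs) / (m * r))"
  have "S \<subseteq> cball xs R"
  proof
    fix x assume x: "x \<in> S"
    show "x \<in> cball xs R"
    proof (cases "norm (x - xs) \<le> r")
      case True
      thus ?thesis by (simp add: R_def dist_norm norm_minus_commute)
    next
      case False
      define n where "n = norm (x - xs)"
      define t where "t = r / n"
      have n: "r < n" using False by (simp add: n_def)
      have t: "0 < t" "t < 1" "t * n = r" using n r(1) by (auto simp: t_def)
      define y where "y = (1 - t) *\<^sub>R xs + t *\<^sub>R x"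
      have yx: "y - xs = t *\<^sub>R (x - xs)" by (simp add: y_def algebra_simps)
      hence ny: "norm (y - xs) = r" using t by (simp add: n_def)
      have "F xs + m / 2 * (norm (y - xs))\<^sup>2 \<le> F y"
        using ny r(1) by (intro quadratic_growth[OF convex_cball K] m(2)) (auto simp: dist_norm norm_minus_commute)
      also have "F y \<le> (1 - t) * F xs + t * F x"
        unfolding y_def using t S_dom[OF x] S_dom[OF xs_S] by (intro convex_onD[OF F_convex]) auto
      finally have "m / 2 * r\<^sup>2 \<le> t * (F x - F xs)" by (simp add: ny algebra_simps)
      also have "\<dots> \<le> t * (F x0 - F xs)" using x t by (intro mult_left_mono) (auto simp: mem_S_iff)
      finally have "n * (m / 2 * r\<^sup>2) \<le> n * (t * (F x0 - F xs))"
        using n r(1) by (intro mult_left_mono) auto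
      also have "\<dots> = r * (F x0 - F xs)" using t(3) by (metis mult.assoc mult.commute)
      finally have "n * (m * r) * r \<le> 2 * (F x0 - F xs) * r" by (simp add: power2_eq_square algebra_simps)
      hence "n * (m * r) \<le> 2 * (F x0 - F xs)" using r(1) by simp
      hence "n \<le> 2 * (F x0 - F xs) / (m * r)" using m(1) r(1) by (simp add: pos_le_divide_eq)
      thus ?thesis by (simp add: R_def n_def dist_norm norm_minus_commute)
    qed
  qed
  hence "bounded S" by (rule bounded_subset[OF bounded_cball])
  moreover have "closed S"
    using closed_sublevel_add[OF f_not_MInf cl_f g_not_MInf cl_g, of "F x0"]
    by (simp add: S_def objective_eq x0_dom) (simp add: objective_def)
  ultimately show ?thesis by (simp add: compact_eq_bounded_closed)
qed

section \<open>The error bound and the contraction\<close>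

text \<open>Let \<open>\<Delta>\<close> be the optimality gap at \<open>x\<close>. The change \<open>q\<close> of the model from \<open>0\<close> to the optimal \<open>d\<close> is caught between
  two bounds.

  The direction \<open>s e\<close> with \<open>e = xs - x\<close> is a competitor. By convexity its first-order part is at most
  \<open>- s \<Delta>\<close>, and its quadratic part is at most \<open>s\<^sup>2 M / m \<Delta>\<close> by quadratic growth at \<open>xs\<close>. For
  \<open>s = m / (2 M)\<close> this gives \<open>q \<le> - m / (4 M) \<Delta>\<close>.

  Conversely, \<open>q\<close> is at least the inner product of \<open>d\<close> with the gradient \<open>G\<close> of the objective at \<open>x\<close>. As \<open>G\<close>
  vanishes at \<open>xs\<close>, its norm is at most \<open>(M + L)\<close> times the distance to \<open>xs\<close>, hence of the order of
  \<open>sqrt \<Delta>\<close>. This is where the Lipschitz continuity of the gradient of \<open>g\<close> enters. The norm of \<open>d\<close> is of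
  the order of its local norm \<open>l\<close>.

  So \<open>\<Delta>\<close> is at most a multiple of \<open>sqrt \<Delta> l\<close>, that is, of \<open>l\<^sup>2\<close> after squaring and cancelling.\<close>

lemma error_bound_at:
  assumes m: "0 < m" "m \<le> M"
    and lo: "\<And>y v. y \<in> S \<Longrightarrow> m * (norm v)\<^sup>2 \<le> v \<bullet> (hessian (real_part f) y *v v)"
    and up: "\<And>y v. y \<in> S \<Longrightarrow> norm (hessian (real_part f) y *v v) \<le> M * norm v"
    and L: "L-lipschitz_on S (gradient (real_part g))"
    and x: "x \<in> S" and sol: "solves_subproblem f g x d"
  shows "F x - F xs \<le> 32 * M\<^sup>2 * (M + L)\<^sup>2 / m ^ 4 * (local_norm f x d)\<^sup>2"
proof -
  let ?f = "real_part f" and ?g = "real_part g"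
  let ?H = "hessian ?f"
  define \<Delta> where "\<Delta> = F x - F xs"
  define e where "e = xs - x"
  define n where "n = norm e"
  define s where "s = m / (2 * M)"
  define G where "G = gradient ?f x + gradient ?g x"
  have \<Delta>0: "0 \<le> \<Delta>" using F_min S_dom[OF x] by (simp add: \<Delta>_def)
  have L0: "0 \<le> L" using L by (rule lipschitz_on_nonneg)
  have M0: "0 < M" using m by simp
  have s: "0 < s" "s \<le> 1" using m M0 by (auto simp: s_def field_simps)
  have Sdom: "S \<subseteq> edom f \<inter> edom g" using S_dom by auto
  have n2: "m / 2 * n\<^sup>2 \<le> \<Delta>"
    using quadratic_growth[OF convex_S Sdom xs_S x lo]
    by (simp add: \<Delta>_def n_def e_def norm_minus_commute)
  have seg: "x + t *\<^sub>R e \<in> S" if "0 \<le> t" "t \<le> 1" for t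
  proof -
    have "x + t *\<^sub>R e = (1 - t) *\<^sub>R x + t *\<^sub>R xs" by (simp add: e_def algebra_simps)
    also have "\<dots> \<in> S" using that by (intro convexD[OF convex_S] x xs_S) auto
    finally show ?thesis .
  qed
  have xd: "x + d \<in> edom g" and best: "pn_model f g x d \<le> pn_model f g x (s *\<^sub>R e)"
    using sol seg[of s] s S_dom by (auto simp: solves_subproblem_def)
  have model: "pn_model f g x d - ?g x \<le> - (m / (4 * M) * \<Delta>)"
  proof -
    define P where "P = m / (2 * M) * \<Delta>"
    have g_le: "?g (x + s *\<^sub>R e) \<le> ?g x - s * ?g x + s * ?g xs"
    proof -
      have "x + s *\<^sub>R e = (1 - s) *\<^sub>R x + s *\<^sub>R xs" by (simp add: e_def algebra_simps)
      hence "?g (x + s *\<^sub>R e) \<le> (1 - s) * ?g x + s * ?g xs"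
        using s S_dom x xs_S by (auto intro!: convex_onD[OF cvx_g])
      thus ?thesis by (simp add: left_diff_distrib)
    qed
    have "?f x + e \<bullet> gradient ?f x \<le> ?f xs"
      unfolding e_def using S_dom x xs_S by (intro convex_above_gradient_plane[OF cvx_f] f_diff) auto
    hence f_le: "s * (e \<bullet> gradient ?f x) \<le> s * (?f xs - ?f x)" using s by (intro mult_left_mono) auto
    have "s\<^sup>2 * (e \<bullet> (?H x *v e)) \<le> s\<^sup>2 * (M * (2 * \<Delta> / m))"
    proof (intro mult_left_mono)
      have "e \<bullet> (?H x *v e) \<le> n * norm (?H x *v e)"
        unfolding n_def by (rule norm_cauchy_schwarz)
      also have "\<dots> \<le> n * (M * n)" using up[OF x] unfolding n_def by (intro mult_left_mono) auto
      also have "\<dots> = M * n\<^sup>2" by (simp add: power2_eq_square)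
      also have "\<dots> \<le> M * (2 * \<Delta> / m)" using n2 m M0 by (intro mult_left_mono) (auto simp: field_simps)
      finally show "e \<bullet> (?H x *v e) \<le> M * (2 * \<Delta> / m)" .
    qed auto
    also have "s\<^sup>2 * (M * (2 * \<Delta> / m)) = P"
      using m M0 by (simp add: P_def s_def power2_eq_square field_simps)
    finally have quad_le: "s\<^sup>2 * (e \<bullet> (?H x *v e)) \<le> P" .
    have model_eq: "pn_model f g x (s *\<^sub>R e)
        = s * (e \<bullet> gradient ?f x) + 1/2 * (s\<^sup>2 * (e \<bullet> (?H x *v e))) + ?g (x + s *\<^sub>R e)"
      by (simp add: pn_model_def matrix_vector_mult_scaleR power2_eq_square inner_commute)
    have sum_eq: "s * (?f xs - ?f x) + s * ?g xs = s * ?g x - P"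
      unfolding P_def s_def[symmetric] \<Delta>_def F_def by (simp add: algebra_simps)
    have "m / (4 * M) * \<Delta> = P / 2" by (simp add: P_def)
    moreover have "q - b \<le> - (P / 2)"
      if "q \<le> u + 1/2 * r + h" "h \<le> b - v + w" "u \<le> z" "r \<le> P" "z + w = v - P"
      for q u r h b v w z :: real
      using that by linarith
    note this[OF best[unfolded model_eq] g_le f_le quad_le sum_eq]
    ultimately show ?thesis by (simp only:)
  qed
  have "m / (4 * M) * \<Delta> \<le> norm d * norm G"
  proof -
    have "?g x + d \<bullet> gradient ?g x \<le> ?g (x + d)"
      using convex_above_gradient_plane[OF cvx_g g_diff[OF x] _ xd] S_dom[OF x] by simp
    moreover have "0 \<le> d \<bullet> (?H x *v d)"
      using lo[OF x, of d] m(1) by (meson dual_order.trans less_imp_le mult_nonneg_nonneg zero_le_power2)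
    moreover have "d \<bullet> G = gradient ?f x \<bullet> d + d \<bullet> gradient ?g x"
      by (simp add: G_def inner_add_right inner_commute)
    moreover have "- (norm d * norm G) \<le> d \<bullet> G"
      using Cauchy_Schwarz_ineq2[of d G] by linarith
    ultimately show ?thesis using model unfolding pn_model_def by linarith
  qed
  also have "norm d * norm G \<le> norm d * ((M + L) * n)"
  proof (rule mult_left_mono)
    have "norm (gradient ?f x - gradient ?f xs) \<le> M * norm (x - xs)"
    proof (rule differentiable_bound[OF convex_S _ _ x xs_S])
      fix y assume y: "y \<in> S"
      show "(gradient ?f has_derivative (\<lambda>v. ?H y *v v)) (at y within S)"
        using hessian_works[OF open_f C3_f S_dom(1)[OF y]] by (rule has_derivative_at_withinI)
      show "onorm (\<lambda>v. ?H y *v v) \<le> M" using up[OF y] by (rule onorm_le)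
    qed
    moreover have "norm (gradient ?g x - gradient ?g xs) \<le> L * norm (x - xs)"
      by (rule lipschitz_on_normD[OF L x xs_S])
    moreover have "G = (gradient ?f x - gradient ?f xs) + (gradient ?g x - gradient ?g xs)"
      using stationary by (simp add: G_def algebra_simps)
    hence "norm G \<le> norm (gradient ?f x - gradient ?f xs) + norm (gradient ?g x - gradient ?g xs)"
      by (metis norm_triangle_ineq)
    moreover have "norm (x - xs) = n" by (simp add: n_def e_def norm_minus_commute)
    ultimately show "norm G \<le> (M + L) * n" by (simp add: distrib_right)
  qed simp
  finally have "(m / (4 * M) * \<Delta>)\<^sup>2 \<le> (norm d * ((M + L) * n))\<^sup>2"
    using \<Delta>0 m M0 by (intro power_mono) auto
  also have "\<dots> = (M + L)\<^sup>2 * ((norm d)\<^sup>2 * n\<^sup>2)" by (simp add: power_mult_distrib)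
  also have "\<dots> \<le> (M + L)\<^sup>2 * ((local_norm f x d)\<^sup>2 / m * (2 * \<Delta> / m))"
  proof (intro mult_left_mono mult_mono)
    have "m * (norm d)\<^sup>2 \<le> d \<bullet> (?H x *v d)" by (rule lo[OF x])
    also have "\<dots> \<le> (local_norm f x d)\<^sup>2"
      unfolding local_norm_def using calculation m(1)
      by (smt (verit) real_sqrt_pow2 mult_nonneg_nonneg zero_le_power2)
    finally show "(norm d)\<^sup>2 \<le> (local_norm f x d)\<^sup>2 / m" using m(1) by (simp add: field_simps)
    show "n\<^sup>2 \<le> 2 * \<Delta> / m" using n2 m(1) by (simp add: field_simps)
  qed (use m(1) in auto)
  finally have prod: "m\<^sup>2 / (16 * M\<^sup>2) * \<Delta> * \<Delta> \<le> 2 * (M + L)\<^sup>2 * (local_norm f x d)\<^sup>2 / m\<^sup>2 * \<Delta>"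
    by (simp add: power2_eq_square field_simps)
  have "\<Delta> \<le> 32 * M\<^sup>2 * (M + L)\<^sup>2 / m ^ 4 * (local_norm f x d)\<^sup>2" if "0 < \<Delta>"
  proof -
    have "m\<^sup>2 / (16 * M\<^sup>2) * \<Delta> \<le> 2 * (M + L)\<^sup>2 * (local_norm f x d)\<^sup>2 / m\<^sup>2"
      using prod that by (rule mult_right_le_imp_le)
    thus ?thesis using m(1) M0 by (simp add: field_simps power4_eq_xxxx power2_eq_square)
  qed
  moreover have "0 \<le> 32 * M\<^sup>2 * (M + L)\<^sup>2 / m ^ 4 * (local_norm f x d)\<^sup>2" using m(1) by simp
  ultimately show ?thesis unfolding \<Delta>_def[symmetric] by linarith
qed

lemma error_bound:
  obtains K where "0 < K"
    "\<And>x d. x \<in> S \<Longrightarrow> solves_subproblem f g x d \<Longrightarrow> F x - F xs \<le> K * (local_norm f x d)\<^sup>2"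
proof -
  obtain L where L: "L-lipschitz_on S (gradient (real_part g))"
    using smooth by (auto simp: lipschitz_differentiable_on_def S_def)
  have "\<exists>m M. 0 < m \<and> m \<le> M
      \<and> (\<forall>y\<in>S. \<forall>v. m * (norm v)\<^sup>2 \<le> v \<bullet> (hessian (real_part f) y *v v))
      \<and> (\<forall>y\<in>S. \<forall>v. norm (hessian (real_part f) y *v v) \<le> M * norm v)"
  proof (rule hessian_bounds_on_compact[OF compact_S])
    show "continuous_on S (hessian (real_part f))"
      using S_dom by (intro continuous_on_subset[OF hessian_cont]) auto
    show "\<And>y. y \<in> S \<Longrightarrow> positive_definite (hessian (real_part f) y)"
      using S_dom by (intro hessian_pd) auto
    show "S \<noteq> {}" using x0_S by auto
  qed blast
  then obtain m M where mM: "0 < m" "m \<le> M"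
      "\<And>y v. y \<in> S \<Longrightarrow> m * (norm v)\<^sup>2 \<le> v \<bullet> (hessian (real_part f) y *v v)"
      "\<And>y v. y \<in> S \<Longrightarrow> norm (hessian (real_part f) y *v v) \<le> M * norm v" by blast
  have "0 < 32 * M\<^sup>2 * (M + L)\<^sup>2 / m ^ 4"
    using mM(1,2) lipschitz_on_nonneg[OF L] by (auto simp: power2_eq_square)
  thus thesis using error_bound_at[OF mM L] that by blast
qed

text \<open>A step decreases the objective by at least \<open>l\<^sup>2 / (2 (1 + l))\<close>. This decrease cannot exceed the initial gap \<open>D\<close>,
  which gives \<open>l \<le> 2 D + 1\<close> and therefore a decrease of at least \<open>l\<^sup>2 / (4 (D + 1))\<close>. By the error bound
  this is a fixed fraction \<open>c\<close> of the current gap.\<close>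

lemma linear_convergence:
  assumes dir: "\<And>x. x \<in> S \<Longrightarrow> solves_subproblem f g x (dir x)"
  shows "\<exists>q. 0 < q \<and> q < 1 \<and> (\<forall>k. (damped_step f dir ^^ k) x0 \<in> S \<and>
    F ((damped_step f dir ^^ k) x0) - F xs \<le> q ^ k * (F x0 - F xs))"
proof -
  define D where "D = F x0 - F xs"
  have D: "0 \<le> D" using F_min x0_dom by (simp add: D_def)
  obtain K where K: "0 < K"
    "\<And>x d. x \<in> S \<Longrightarrow> solves_subproblem f g x d \<Longrightarrow> F x - F xs \<le> K * (local_norm f x d)\<^sup>2"
    using error_bound by blast
  define c where "c = 1 / (4 * (D + 1) * K)"
  have c: "0 < c" using D K(1) by (simp add: c_def)
  \<comment> \<open>The maximum only ensures \<open>q > 0\<close>: nothing prevents \<open>c\<close> from being at least \<open>1\<close>.\<close>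
  define q where "q = max (1/2) (1 - c)"
  have q: "0 < q" "q < 1" using c by (auto simp: q_def)
  have step: "damped_step f dir x \<in> S \<and> F (damped_step f dir x) - F xs \<le> q * (F x - F xs)"
    if x: "x \<in> S" for x
  proof -
    define l where "l = local_norm f x (dir x)"
    define y where "y = damped_step f dir x"
    have l: "0 \<le> l"
      using hessian_pd[OF S_dom[OF x]] unfolding l_def local_norm_def positive_definite_def
      by (cases "dir x = 0") (auto intro: less_imp_le)
    note dec = damped_step_decrease[where dir = dir and x = x, OF sc cvx_g hessian_pd S_dom[OF x] dir[OF x], folded l_def y_def]
    have Fy: "F y \<le> F x - (l - ln (1 + l))" using dec(3) by (simp add: F_def)
    have w: "l\<^sup>2 / (2 * (1 + l)) \<le> l - ln (1 + l)"
      using l by (rule ln_add_one_le_self_minus_quadratic)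
    have "0 \<le> l\<^sup>2 / (2 * (1 + l))" using l by simp
    hence "F y \<le> F x" using Fy w by linarith
    hence yS: "y \<in> S" using dec x by (simp add: mem_S_iff)
    have "l\<^sup>2 / (2 * (1 + l)) \<le> D"
      using Fy w F_min[OF dec(1,2)] x unfolding D_def by (auto simp: mem_S_iff)
    hence l2: "l * l \<le> 2 * D * (1 + l)" using l by (simp add: divide_simps power2_eq_square mult_ac)
    have lD: "l \<le> 2 * D + 1"
    proof (rule ccontr)
      assume "\<not> l \<le> 2 * D + 1"
      hence "(2 * D + 1) * l \<le> l * l" "2 * D + 1 < l" using l by (auto intro: mult_right_mono)
      thus False using l2 by (simp add: algebra_simps)
    qed
    have "c * (F x - F xs) \<le> c * (K * l\<^sup>2)"
      using c K(2)[OF x dir[OF x]] unfolding l_def by (intro mult_left_mono) auto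
    also have "\<dots> = l\<^sup>2 / (4 * (D + 1))" using K(1) by (simp add: c_def)
    also have "\<dots> \<le> l\<^sup>2 / (2 * (1 + l))" using l lD by (intro divide_left_mono) auto
    also have "\<dots> \<le> F x - F y" using w Fy by linarith
    finally have "F y - F xs \<le> (1 - c) * (F x - F xs)" by (simp add: algebra_simps)
    also have "\<dots> \<le> q * (F x - F xs)"
      using F_min S_dom[OF x] by (intro mult_right_mono) (auto simp: q_def)
    finally show ?thesis using yS by (simp add: y_def)
  qed
  have "(damped_step f dir ^^ k) x0 \<in> S \<and>
    F ((damped_step f dir ^^ k) x0) - F xs \<le> q ^ k * (F x0 - F xs)" for k
  proof (induction k)
    case 0
    show ?case by (simp add: x0_S)
  next
    case (Suc k)
    let ?x = "(damped_step f dir ^^ k) x0"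
    have "F (damped_step f dir ?x) - F xs \<le> q * (F ?x - F xs)" using step Suc by blast
    also have "\<dots> \<le> q * (q ^ k * (F x0 - F xs))" using Suc q by (intro mult_left_mono) auto
    finally show ?case using step Suc by (simp add: mult.assoc)
  qed
  thus ?thesis using q by blast
qed

lemma linear_convergence_objective:
  assumes "\<And>x. x \<in> S \<Longrightarrow> solves_subproblem f g x (dir x)"
  shows "\<exists>q::real. 0 < q \<and> q < 1 \<and> (\<forall>k. objective f g ((damped_step f dir ^^ k) x0) - opt_value f g
      \<le> ereal (q ^ k) * (objective f g x0 - opt_value f g))"
proof -
  have opt: "opt_value f g = ereal (F xs)"
  proof -
    have "opt_value f g = objective f g xs" unfolding opt_value_def
      by (rule antisym) (auto intro: INF_lower INF_greatest xs_min)
    thus ?thesis by (simp add: objective_eq S_dom xs_S)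
  qed
  obtain q where q: "0 < q" "q < 1" "\<And>k. (damped_step f dir ^^ k) x0 \<in> S"
    "\<And>k. F ((damped_step f dir ^^ k) x0) - F xs \<le> q ^ k * (F x0 - F xs)"
    using linear_convergence[OF assms] by blast
  have "objective f g ((damped_step f dir ^^ k) x0) - opt_value f g
      \<le> ereal (q ^ k) * (objective f g x0 - opt_value f g)" for k
    using q(4)[of k] by (simp add: opt objective_eq S_dom[OF q(3)] x0_dom)
  thus ?thesis using q by blast
qed

lemma pn_direction_solves_subproblem:
  assumes x: "x \<in> S"
  shows "solves_subproblem f g x (pn_direction f g x)"
proof -
  note iff = is_arg_min_iff_solves_subproblem[OF f_not_MInf g_not_MInf S_dom[OF x]]
  obtain d where "solves_subproblem f g x d"
    using subproblem_solution_exists[OF g_not_MInf ccg S_dom(2)[OF x] g_diff[OF x] hessian_pd[OF S_dom[OF x]]]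
    by blast
  thus ?thesis unfolding pn_direction_def arg_min_def iff by (rule someI)
qed

end

lemma smooth_composite_problemI:
  assumes "composite_problem f g" "x0 \<in> edom (objective f g)"
    "lipschitz_differentiable_on g {x. objective f g x \<le> objective f g x0}"
  obtains xs where "smooth_composite_problem f g x0 xs"
proof -
  obtain xs where "is_arg_min (objective f g) (\<lambda>_. True) xs"
    using assms(1) by (auto simp: composite_problem_def)
  thus thesis using that assms by (auto simp: smooth_composite_problem_def is_arg_min_linorder)
qed

lemma lipschitz_differentiable_zero: "lipschitz_differentiable_on (\<lambda>_. 0 :: ereal) (S :: (real ^ 'n) set)"
proof -
  have "real_part (\<lambda>_ :: real ^ 'n. 0) = (\<lambda>_. 0)" "edom (\<lambda>_ :: real ^ 'n. 0) = UNIV"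
    by (auto simp: real_part_def edom_def)
  moreover have "gradient (\<lambda>_. 0) = (\<lambda>_ :: real ^ 'n. 0)"
    by (intro ext gradient_eqI) simp
  moreover have "0-lipschitz_on S (\<lambda>_. 0 :: real ^ 'n)" by (rule lipschitz_onI) auto
  ultimately show ?thesis unfolding lipschitz_differentiable_on_def by auto
qed

theorem corollary2:
  fixes f g :: "real ^ 'n \<Rightarrow> ereal" and x0 :: "real ^ 'n"
  shows "(composite_problem f g \<and> x0 \<in> edom (objective f g) \<and>
          lipschitz_differentiable_on g {x. objective f g x \<le> objective f g x0}
          \<longrightarrow> (\<exists>q::real. 0 < q \<and> q < 1 \<and>
                (\<forall>k. objective f g (pdn_iter f g x0 k) - opt_value f g
                       \<le> ereal (q ^ k) * (objective f g x0 - opt_value f g)))) \<and>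
         (composite_problem f (\<lambda>_. 0) \<and> x0 \<in> edom f
          \<longrightarrow> (\<exists>q::real. 0 < q \<and> q < 1 \<and>
                (\<forall>k. f (dn_iter f x0 k) - (INF x. f x)
                       \<le> ereal (q ^ k) * (f x0 - (INF x. f x)))))"
proof (intro conjI impI; elim conjE)
  assume A: "composite_problem f g" "x0 \<in> edom (objective f g)"
    "lipschitz_differentiable_on g {x. objective f g x \<le> objective f g x0}"
  then obtain xs where "smooth_composite_problem f g x0 xs" by (rule smooth_composite_problemI)
  then interpret smooth_composite_problem f g x0 xs .
  show "\<exists>q::real. 0 < q \<and> q < 1 \<and>
                (\<forall>k. objective f g (pdn_iter f g x0 k) - opt_value f g
                       \<le> ereal (q ^ k) * (objective f g x0 - opt_value f g))"
    unfolding pdn_iter_def by (rule linear_convergence_objective[OF pn_direction_solves_subproblem])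
next
  assume A: "composite_problem f (\<lambda>_. 0)" "x0 \<in> edom f"
  have obj: "objective f (\<lambda>_. 0) = f" by (simp add: objective_def fun_eq_iff)
  obtain xs where "smooth_composite_problem f (\<lambda>_. 0) x0 xs"
    using smooth_composite_problemI[OF A(1) _ lipschitz_differentiable_zero] A(2) obj by metis
  then interpret smooth_composite_problem f "\<lambda>_. 0" x0 xs .
  have "solves_subproblem f (\<lambda>_. 0) x (newton_direction f x)" if "x \<in> S" for x
    using that by (intro newton_direction_solves_subproblem hessian_pd S_dom)
  from linear_convergence_objective[of "newton_direction f", OF this]
  show "\<exists>q::real. 0 < q \<and> q < 1 \<and> (\<forall>k. f (dn_iter f x0 k) - (INF x. f x)
                       \<le> ereal (q ^ k) * (f x0 - (INF x. f x)))"
    by (simp add: dn_iter_def obj opt_value_def)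
qed

end
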